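(* Let $\Gamma$ be a discrete group satisfying the approximation property, which acts freely on a compact Hausdorff space $X$. The map $$ U \mapsto \overline{\operatorname{span}}\{ f u_g \colon g\in\Gamma,\ f\in C(X),\ \operatorname{supp}(f) \subseteq \pi_g(U) \} $$ defines a one-to-one correspondence between open subsets $U \subseteq \Gamma \times X$ and norm-closed $C(X)$-bimodules in the reduced crossed product $C(X) \rtimes_r \Gamma$.
   Context: $\Gamma$ acts on $X$ by homeomorphisms, and $\Gamma\times X$ has the product topology ($\Gamma$ discrete). $C(X)$ is viewed as a subalgebra of the reduced crossed product $C(X)\rtimes_r\Gamma$, and $\{u_g\}_{g\in\Gamma}$ denotes the canonical unitary representation of $\Gamma$ in $C(X)\rtimes_r\Gamma$. The action is free if for each $g\ne e$ in $\Gamma$ the set $\{x\in X: g\cdot x=x\}$ is empty. For $g\in\Gamma$ and $U\subseteq\Gamma\times X$, $\pi_g(U)=\{x\in X:(g,x)\in U\}$. Here $\operatorname{supp}(f)=\{x\in X: f(x)\neq 0\}$. A $C(X)$-bimodule in $C(X)\rtimes_r\Gamma$ is a linear subspace $M$ with $C(X)\,M\,C(X)\subseteq M$. Approximation property: a discrete group $\Gamma$ has the approximation property if the constant function $1$ is in the weak$^*$-closure of the space of finitely supported functions on $\Gamma$; explicitly, if there exists a net $(f_\alpha)$ of finitely supported functions on $\Gamma$ such that for every $\varphi\in\ell^1(\Gamma)$, $\sum_{\gamma\in\Gamma}\varphi(\gamma)f_\alpha(\gamma)\to\sum_{\gamma\in\Gamma}\varphi(\gamma)$.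
   Formalization: The approximation property is that of Haagerup–Kraus (weak*-closure in the completely bounded multipliers, tested on their predual Q(Γ)); testing only against ℓ¹(Γ) holds for every group, and the claim then fails for non-exact Γ acting on βΓ. *)

theory Defs
  imports "HOL-Analysis.Analysis"
begin

section \<open>The Hilbert space of square-summable functions\<close>

text \<open>
  The complex Hilbert space \<open>\<ell>\<^sup>2(I)\<close> is presented as a real inner product space (with the
  real part of the usual inner product, hence with the usual norm), so that the library type
  \<open>\<Rightarrow>\<^sub>L\<close> of bounded real-linear maps with the operator norm can be used.  All operators that
  occur below are in fact complex linear.  The complex structure enters through \<open>cop_scale\<close>.
\<close>

typedef 'i ell2 = "{f :: 'i \<Rightarrow> complex. (\<lambda>i. (cmod (f i))\<^sup>2) summable_on UNIV}"
  by (rule exI[of _ "\<lambda>_. 0"]) simp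

setup_lifting type_definition_ell2

lemma ell2_dominated:
  fixes f :: "'i \<Rightarrow> complex" and h :: "'j \<Rightarrow> complex"
  assumes f: "(\<lambda>i. (cmod (f i))\<^sup>2) summable_on UNIV"
    and inj: "inj_on \<sigma> A"
    and le: "\<And>j. j \<in> A \<Longrightarrow> cmod (h j) \<le> B * cmod (f (\<sigma> j))"
    and zero: "\<And>j. j \<notin> A \<Longrightarrow> h j = 0"
  shows "(\<lambda>j. (cmod (h j))\<^sup>2) summable_on UNIV"
    and "(\<Sum>\<^sub>\<infinity>j. (cmod (h j))\<^sup>2) \<le> B\<^sup>2 * (\<Sum>\<^sub>\<infinity>i. (cmod (f i))\<^sup>2)"
proof -
  have le2: "(cmod (h j))\<^sup>2 \<le> B\<^sup>2 * (cmod (f (\<sigma> j)))\<^sup>2" if "j \<in> A" for j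
    using power_mono[OF le[OF that], of 2] by (simp add: power_mult_distrib)
  have s1: "(\<lambda>i. (cmod (f i))\<^sup>2) summable_on \<sigma> ` A"
    using f by (rule summable_on_subset_banach) simp
  then have s2: "(\<lambda>j. (cmod (f (\<sigma> j)))\<^sup>2) summable_on A"
    unfolding summable_on_reindex[OF inj] o_def .
  have s3: "(\<lambda>j. B\<^sup>2 * (cmod (f (\<sigma> j)))\<^sup>2) summable_on A"
    using s2 by (rule summable_on_cmult_right)
  have s4: "(\<lambda>j. (cmod (h j))\<^sup>2) summable_on A"
    by (rule summable_on_comparison_test[OF s3]) (auto simp: le2)
  show "(\<lambda>j. (cmod (h j))\<^sup>2) summable_on UNIV"
    using s4 by (subst summable_on_cong_neutral[where T = A]) (auto simp: zero)
  have "(\<Sum>\<^sub>\<infinity>j. (cmod (h j))\<^sup>2) = (\<Sum>\<^sub>\<infinity>j\<in>A. (cmod (h j))\<^sup>2)"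
    by (rule infsum_cong_neutral) (auto simp: zero)
  also have "\<dots> \<le> (\<Sum>\<^sub>\<infinity>j\<in>A. B\<^sup>2 * (cmod (f (\<sigma> j)))\<^sup>2)"
    by (rule infsum_mono[OF s4 s3]) (rule le2)
  also have "\<dots> = B\<^sup>2 * (\<Sum>\<^sub>\<infinity>i\<in>\<sigma> ` A. (cmod (f i))\<^sup>2)"
    by (simp add: infsum_cmult_right' infsum_reindex[OF inj] o_def)
  also have "\<dots> \<le> B\<^sup>2 * (\<Sum>\<^sub>\<infinity>i. (cmod (f i))\<^sup>2)"
    by (intro mult_left_mono infsum_mono_neutral s1 f) auto
  finally show "(\<Sum>\<^sub>\<infinity>j. (cmod (h j))\<^sup>2) \<le> B\<^sup>2 * (\<Sum>\<^sub>\<infinity>i. (cmod (f i))\<^sup>2)" .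
qed

lemma ell2_add_aux:
  fixes f g :: "'i \<Rightarrow> complex"
  assumes "(\<lambda>i. (cmod (f i))\<^sup>2) summable_on UNIV" "(\<lambda>i. (cmod (g i))\<^sup>2) summable_on UNIV"
  shows "(\<lambda>i. (cmod (f i + g i))\<^sup>2) summable_on UNIV"
proof (rule summable_on_comparison_test)
  show "(\<lambda>i. 2 * (cmod (f i))\<^sup>2 + 2 * (cmod (g i))\<^sup>2) summable_on UNIV"
    by (intro summable_on_add summable_on_cmult_right assms)
  fix i
  have "(cmod (f i + g i))\<^sup>2 \<le> (cmod (f i) + cmod (g i))\<^sup>2"
    by (intro power_mono norm_triangle_ineq) auto
  also have "\<dots> \<le> 2 * (cmod (f i))\<^sup>2 + 2 * (cmod (g i))\<^sup>2"
    using sum_squares_bound[of "cmod (f i)" "cmod (g i)"] unfolding power2_sum by linarith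
  finally show "(cmod (f i + g i))\<^sup>2 \<le> 2 * (cmod (f i))\<^sup>2 + 2 * (cmod (g i))\<^sup>2" .
qed auto

lemma ell2_inner_aux:
  fixes f g :: "'i \<Rightarrow> complex"
  assumes "(\<lambda>i. (cmod (f i))\<^sup>2) summable_on UNIV" "(\<lambda>i. (cmod (g i))\<^sup>2) summable_on UNIV"
  shows "(\<lambda>i. f i \<bullet> g i) summable_on UNIV"
proof -
  have "(\<lambda>i. \<bar>f i \<bullet> g i\<bar>) summable_on UNIV"
  proof (rule summable_on_comparison_test)
    show "(\<lambda>i. (cmod (f i))\<^sup>2 + (cmod (g i))\<^sup>2) summable_on UNIV"
      by (intro summable_on_add assms)
    fix i
    have "\<bar>f i \<bullet> g i\<bar> \<le> cmod (f i) * cmod (g i)"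
      by (rule Cauchy_Schwarz_ineq2)
    also have "\<dots> \<le> (cmod (f i))\<^sup>2 + (cmod (g i))\<^sup>2"
      using sum_squares_bound[of "cmod (f i)" "cmod (g i)"]
        mult_nonneg_nonneg[OF norm_ge_zero[of "f i"] norm_ge_zero[of "g i"]] by linarith
    finally show "\<bar>f i \<bullet> g i\<bar> \<le> (cmod (f i))\<^sup>2 + (cmod (g i))\<^sup>2" .
  qed auto
  then show ?thesis
    by (rule summable_on_iff_abs_summable_on_real[THEN iffD2, unfolded real_norm_def])
qed

instantiation ell2 :: (type) real_vector
begin

lift_definition zero_ell2 :: "'a ell2" is "\<lambda>_. 0" by simp

lift_definition plus_ell2 :: "'a ell2 \<Rightarrow> 'a ell2 \<Rightarrow> 'a ell2" is "\<lambda>f g i. f i + g i"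
  by (rule ell2_add_aux)

lift_definition uminus_ell2 :: "'a ell2 \<Rightarrow> 'a ell2" is "\<lambda>f i. - f i" by simp

definition minus_ell2 :: "'a ell2 \<Rightarrow> 'a ell2 \<Rightarrow> 'a ell2" where
  "minus_ell2 f g = f + - g"

lift_definition scaleR_ell2 :: "real \<Rightarrow> 'a ell2 \<Rightarrow> 'a ell2" is "\<lambda>r f i. r *\<^sub>R f i"
  by (auto simp: power_mult_distrib intro: summable_on_cmult_right)

instance
proof
  fix x y z :: "'a ell2" and r s :: real
  show "x + y + z = x + (y + z)" by transfer (simp add: add.assoc)
  show "x + y = y + x" by transfer (simp add: add.commute)
  show "0 + x = x" by transfer simp
  show "- x + x = 0" by transfer simp
  show "x - y = x + - y" by (simp add: minus_ell2_def)
  show "r *\<^sub>R (x + y) = r *\<^sub>R x + r *\<^sub>R y" by transfer (simp add: scaleR_add_right)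
  show "(r + s) *\<^sub>R x = r *\<^sub>R x + s *\<^sub>R x" by transfer (simp add: scaleR_add_left)
  show "r *\<^sub>R s *\<^sub>R x = (r * s) *\<^sub>R x" by transfer simp
  show "1 *\<^sub>R x = x" by transfer simp
qed

end

instantiation ell2 :: (type) real_inner
begin

lift_definition inner_ell2 :: "'a ell2 \<Rightarrow> 'a ell2 \<Rightarrow> real" is "\<lambda>f g. \<Sum>\<^sub>\<infinity>i. f i \<bullet> g i" .

definition norm_ell2 :: "'a ell2 \<Rightarrow> real" where
  "norm_ell2 f = sqrt (f \<bullet> f)"

definition sgn_ell2 :: "'a ell2 \<Rightarrow> 'a ell2" where
  "sgn_ell2 f = f /\<^sub>R norm f"

definition dist_ell2 :: "'a ell2 \<Rightarrow> 'a ell2 \<Rightarrow> real" where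
  "dist_ell2 f g = norm (f - g)"

definition uniformity_ell2 :: "('a ell2 \<times> 'a ell2) filter" where
  "uniformity_ell2 = (INF e\<in>{0<..}. principal {(x, y). dist x y < e})"

definition open_ell2 :: "'a ell2 set \<Rightarrow> bool" where
  "open_ell2 S = (\<forall>x\<in>S. \<forall>\<^sub>F (x', y) in uniformity. x' = x \<longrightarrow> y \<in> S)"

instance
proof
  fix x y z :: "'a ell2" and r :: real
  show "sgn x = x /\<^sub>R norm x" by (rule sgn_ell2_def)
  show "dist x y = norm (x - y)" by (rule dist_ell2_def)
  show "uniformity = (INF e\<in>{0<..}. principal {(x :: 'a ell2, y). dist x y < e})"
    by (rule uniformity_ell2_def)
  show "open U = (\<forall>x\<in>U. \<forall>\<^sub>F (x', y) in uniformity. x' = x \<longrightarrow> y \<in> U)" for U :: "'a ell2 set"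
    by (rule open_ell2_def)
  show "x \<bullet> y = y \<bullet> x" by transfer (simp add: inner_commute)
  show "(x + y) \<bullet> z = x \<bullet> z + y \<bullet> z"
    by transfer (simp add: inner_add_left infsum_add ell2_inner_aux)
  show "r *\<^sub>R x \<bullet> y = r * (x \<bullet> y)"
    by transfer (simp add: infsum_cmult_right')
  show "0 \<le> x \<bullet> x" by transfer (auto intro: infsum_nonneg)
  show "(x \<bullet> x = 0) = (x = 0)"
  proof transfer
    fix f :: "'a \<Rightarrow> complex"
    assume "(\<lambda>i. (cmod (f i))\<^sup>2) summable_on UNIV"
    then have s: "(\<lambda>i. f i \<bullet> f i) summable_on UNIV" by (simp add: ell2_inner_aux)
    show "((\<Sum>\<^sub>\<infinity>i. f i \<bullet> f i) = 0) = (f = (\<lambda>_. 0))"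
    proof
      assume "(\<Sum>\<^sub>\<infinity>i. f i \<bullet> f i) = 0"
      then have "f i \<bullet> f i = 0" for i
        by (intro nonneg_infsum_le_0D[OF _ s]) auto
      then show "f = (\<lambda>_. 0)" by (simp add: fun_eq_iff)
    qed simp
  qed
  show "norm x = sqrt (x \<bullet> x)" by (rule norm_ell2_def)
qed

end

lemma norm_ell2_eq: "norm x = sqrt (\<Sum>\<^sub>\<infinity>i. (cmod (Rep_ell2 x i))\<^sup>2)"
  unfolding norm_ell2_def by transfer (simp add: power2_norm_eq_inner)

lemma norm_ell2_dominated:
  assumes "inj_on \<sigma> A" "0 \<le> B"
    and "\<And>j. j \<in> A \<Longrightarrow> cmod (Rep_ell2 y j) \<le> B * cmod (Rep_ell2 x (\<sigma> j))"
    and "\<And>j. j \<notin> A \<Longrightarrow> Rep_ell2 y j = 0"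
  shows "norm y \<le> norm x * B"
proof -
  have "(\<Sum>\<^sub>\<infinity>j. (cmod (Rep_ell2 y j))\<^sup>2) \<le> B\<^sup>2 * (\<Sum>\<^sub>\<infinity>i. (cmod (Rep_ell2 x i))\<^sup>2)"
    using Rep_ell2[of x] assms by (intro ell2_dominated(2)[where \<sigma> = \<sigma> and A = A]) auto
  then have "norm y \<le> sqrt (B\<^sup>2 * (\<Sum>\<^sub>\<infinity>i. (cmod (Rep_ell2 x i))\<^sup>2))"
    unfolding norm_ell2_eq by simp
  then show ?thesis
    using assms(2) by (simp add: norm_ell2_eq real_sqrt_mult mult.commute)
qed


section \<open>Complex scalar multiplication of operators\<close>

lift_definition ell2_scale :: "complex \<Rightarrow> 'i ell2 \<Rightarrow> 'i ell2" is "\<lambda>c \<xi> i. c * \<xi> i"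
  by (auto simp: norm_mult power_mult_distrib intro: summable_on_cmult_right)

lift_definition ell2_scale_op :: "complex \<Rightarrow> 'i ell2 \<Rightarrow>\<^sub>L 'i ell2" is ell2_scale
proof (rule bounded_linear_intro)
  fix c r and x y :: "'i ell2"
  show "ell2_scale c (x + y) = ell2_scale c x + ell2_scale c y"
    by transfer (simp add: ring_distribs)
  show "ell2_scale c (r *\<^sub>R x) = r *\<^sub>R ell2_scale c x" by transfer simp
  show "norm (ell2_scale c x) \<le> norm x * cmod c"
    by (rule norm_ell2_dominated[where \<sigma> = id and A = UNIV])
      (auto simp: ell2_scale.rep_eq norm_mult)
qed

definition cop_scale :: "complex \<Rightarrow> ('i ell2 \<Rightarrow>\<^sub>L 'i ell2) \<Rightarrow> ('i ell2 \<Rightarrow>\<^sub>L 'i ell2)" where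
  "cop_scale c T = ell2_scale_op c o\<^sub>L T"

interpretation cop: vector_space cop_scale
proof
  fix a b and S T :: "'i ell2 \<Rightarrow>\<^sub>L 'i ell2"
  show "cop_scale a (S + T) = cop_scale a S + cop_scale a T"
    by (simp add: cop_scale_def bounded_bilinear.add_right[OF bounded_bilinear_blinfun_compose])
  show "cop_scale (a + b) S = cop_scale a S + cop_scale b S"
    unfolding cop_scale_def
    by (intro blinfun_eqI, simp add: blinfun.add_left ell2_scale_op.rep_eq, transfer)
      (simp add: ring_distribs)
  show "cop_scale a (cop_scale b S) = cop_scale (a * b) S"
    unfolding cop_scale_def
    by (intro blinfun_eqI, simp add: ell2_scale_op.rep_eq, transfer) (simp add: mult.assoc)
  show "cop_scale 1 S = S"
    unfolding cop_scale_def
    by (intro blinfun_eqI, simp add: ell2_scale_op.rep_eq, transfer) simp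
qed


section \<open>Group actions and the reduced crossed product\<close>

text \<open>
  The discrete group is a type of class \<open>group_add\<close>.  This class does not assume commutativity;
  the group operation is written \<open>+\<close> and the identity \<open>0\<close>.
\<close>

definition action_by_homeos :: "('g::group_add \<Rightarrow> 'x::topological_space \<Rightarrow> 'x) \<Rightarrow> bool" where
  "action_by_homeos act \<longleftrightarrow>
     (\<forall>x. act 0 x = x) \<and> (\<forall>g h x. act (g + h) x = act g (act h x)) \<and>
     (\<forall>g. homeomorphism UNIV UNIV (act g) (act (- g)))"

definition free_action :: "('g::group_add \<Rightarrow> 'x \<Rightarrow> 'x) \<Rightarrow> bool" where
  "free_action act \<longleftrightarrow> (\<forall>g. g \<noteq> 0 \<longrightarrow> {x. act g x = x} = {})"

text \<open>
  The reduced crossed product is realised by the regular representation on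
  \<open>\<ell>\<^sup>2(\<Gamma>, \<ell>\<^sup>2(X)) = \<ell>\<^sup>2(\<Gamma> \<times> X)\<close> induced from the faithful representation of \<open>C(X)\<close> on \<open>\<ell>\<^sup>2(X)\<close>
  by multiplication: \<open>(f \<xi>)(t, x) = f(t \<cdot> x) \<xi>(t, x)\<close> and \<open>(u\<^sub>g \<xi>)(t, x) = \<xi>(g\<inverse> t, x)\<close>.  Thus
  \<open>u\<^sub>g f u\<^sub>g\<^sup>* = f \<circ> g\<inverse>\<close>.  As usual, the reduced crossed product does not depend on the choice
  of the faithful representation.  For compact \<open>X\<close>, the type \<open>'x \<Rightarrow>\<^sub>C complex\<close> of bounded
  continuous functions is \<open>C(X)\<close>.
\<close>

lift_definition cfun_ell2 ::
    "('g \<Rightarrow> 'x \<Rightarrow> 'x) \<Rightarrow> ('x::topological_space \<Rightarrow>\<^sub>C complex) \<Rightarrow> ('g \<times> 'x) ell2 \<Rightarrow> ('g \<times> 'x) ell2"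
  is "\<lambda>act f \<xi> (t, x). apply_bcontfun f (act t x) * \<xi> (t, x)"
proof -
  fix act :: "'g \<Rightarrow> 'x \<Rightarrow> 'x" and f :: "'x \<Rightarrow>\<^sub>C complex" and \<xi> :: "'g \<times> 'x \<Rightarrow> complex"
  assume \<xi>: "(\<lambda>i. (cmod (\<xi> i))\<^sup>2) summable_on UNIV"
  have B: "cmod (apply_bcontfun f x) \<le> norm f" for x
    by (rule norm_bounded)
  show "(\<lambda>i. (cmod (case i of (t, x) \<Rightarrow> apply_bcontfun f (act t x) * \<xi> (t, x)))\<^sup>2) summable_on UNIV"
    using \<xi>
    by (auto intro!: ell2_dominated(1)[where f = \<xi> and \<sigma> = id and A = UNIV and B = "norm f"]
        mult_right_mono B simp: norm_mult)
qed

lift_definition cfun_op ::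
    "('g \<Rightarrow> 'x \<Rightarrow> 'x) \<Rightarrow> ('x::topological_space \<Rightarrow>\<^sub>C complex) \<Rightarrow> ('g \<times> 'x) ell2 \<Rightarrow>\<^sub>L ('g \<times> 'x) ell2"
  is cfun_ell2
proof (rule bounded_linear_intro)
  fix act :: "'g \<Rightarrow> 'x \<Rightarrow> 'x" and f :: "'x \<Rightarrow>\<^sub>C complex" and r and \<xi> \<eta> :: "('g \<times> 'x) ell2"
  show "cfun_ell2 act f (\<xi> + \<eta>) = cfun_ell2 act f \<xi> + cfun_ell2 act f \<eta>"
    by transfer (auto simp: ring_distribs)
  show "cfun_ell2 act f (r *\<^sub>R \<xi>) = r *\<^sub>R cfun_ell2 act f \<xi>" by transfer auto
  show "norm (cfun_ell2 act f \<xi>) \<le> norm \<xi> * norm f"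
    by (rule norm_ell2_dominated[where \<sigma> = id and A = UNIV])
      (auto simp: cfun_ell2.rep_eq norm_mult intro!: mult_right_mono norm_bounded)
qed

lift_definition unitary_ell2 :: "'g::group_add \<Rightarrow> ('g \<times> 'x) ell2 \<Rightarrow> ('g \<times> 'x) ell2"
  is "\<lambda>g \<xi> (t, x). \<xi> (- g + t, x)"
proof -
  fix g :: 'g and \<xi> :: "'g \<times> 'x \<Rightarrow> complex"
  assume "(\<lambda>i. (cmod (\<xi> i))\<^sup>2) summable_on UNIV"
  then show "(\<lambda>i. (cmod (case i of (t, x) \<Rightarrow> \<xi> (- g + t, x)))\<^sup>2) summable_on UNIV"
    by (auto intro!: ell2_dominated(1)[where f = \<xi> and \<sigma> = "\<lambda>(t, x). (- g + t, x)"
          and A = UNIV and B = 1] simp: inj_on_def)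
qed

lift_definition unitary_op :: "'g::group_add \<Rightarrow> ('g \<times> 'x) ell2 \<Rightarrow>\<^sub>L ('g \<times> 'x) ell2"
  is unitary_ell2
proof (rule bounded_linear_intro)
  fix g :: 'g and r and \<xi> \<eta> :: "('g \<times> 'x) ell2"
  show "unitary_ell2 g (\<xi> + \<eta>) = unitary_ell2 g \<xi> + unitary_ell2 g \<eta>" by transfer auto
  show "unitary_ell2 g (r *\<^sub>R \<xi>) = r *\<^sub>R unitary_ell2 g \<xi>" by transfer auto
  show "norm (unitary_ell2 g \<xi>) \<le> norm \<xi> * 1"
    by (rule norm_ell2_dominated[where \<sigma> = "\<lambda>(t, x). (- g + t, x)" and A = UNIV])
      (auto simp: unitary_ell2.rep_eq inj_on_def)
qed

definition reduced_crossed_product ::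
    "('g::group_add \<Rightarrow> 'x::topological_space \<Rightarrow> 'x) \<Rightarrow> (('g \<times> 'x) ell2 \<Rightarrow>\<^sub>L ('g \<times> 'x) ell2) set" where
  "reduced_crossed_product act = closure (cop.span {cfun_op act f o\<^sub>L unitary_op g | f g. True})"

definition bimodule ::
    "('g::group_add \<Rightarrow> 'x::topological_space \<Rightarrow> 'x) \<Rightarrow> (('g \<times> 'x) ell2 \<Rightarrow>\<^sub>L ('g \<times> 'x) ell2) set \<Rightarrow> bool" where
  "bimodule act M \<longleftrightarrow> M \<subseteq> reduced_crossed_product act \<and> cop.subspace M \<and>
     (\<forall>T\<in>M. \<forall>f h. cfun_op act f o\<^sub>L T o\<^sub>L cfun_op act h \<in> M)"

definition slice :: "'g \<Rightarrow> ('g \<times> 'x) set \<Rightarrow> 'x set" where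
  "slice g U = {x. (g, x) \<in> U}"

text \<open>Following the source, the support of a function is not closed up.\<close>

definition supp :: "('x::topological_space \<Rightarrow>\<^sub>C complex) \<Rightarrow> 'x set" where
  "supp f = {x. apply_bcontfun f x \<noteq> 0}"

definition bimodule_of ::
    "('g::group_add \<Rightarrow> 'x::topological_space \<Rightarrow> 'x) \<Rightarrow> ('g \<times> 'x) set
      \<Rightarrow> (('g \<times> 'x) ell2 \<Rightarrow>\<^sub>L ('g \<times> 'x) ell2) set" where
  "bimodule_of act U =
     closure (cop.span {cfun_op act f o\<^sub>L unitary_op g | f g. supp f \<subseteq> slice g U})"


section \<open>The approximation property\<close>

text \<open>
  The approximation property is that of Haagerup and Kraus: the constant function \<open>1\<close> lies in the
  weak* closure of the finitely supported functions in the dual space \<open>M\<^sub>0A(\<Gamma>) = Q(\<Gamma>)\<^sup>*\<close> of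
  completely bounded Fourier multipliers.  Here \<open>Q(\<Gamma>)\<close> is the completion of \<open>\<ell>\<^sup>1(\<Gamma>)\<close> in the norm
  dual to the one of \<open>M\<^sub>0A(\<Gamma>)\<close>.  Testing against the elements of \<open>\<ell>\<^sup>1(\<Gamma>)\<close> alone would not be
  a restriction on \<open>\<Gamma>\<close>, since the indicator functions of finite sets converge to \<open>1\<close> in that sense.

  \<open>mat_unit_op s i j\<close> is \<open>\<lambda>\<^sub>s \<otimes> e\<^sub>i\<^sub>j\<close> on \<open>\<ell>\<^sup>2(\<Gamma> \<times> \<nat>)\<close>, where \<open>\<lambda>\<close> is the left regular representation.
  Those with \<open>i, j < n\<close> generate a copy of \<open>M\<^sub>n(C\<^sup>*\<^sub>r(\<Gamma>))\<close>.
\<close>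

lift_definition mat_unit_ell2 :: "'g::group_add \<Rightarrow> nat \<Rightarrow> nat \<Rightarrow> ('g \<times> nat) ell2 \<Rightarrow> ('g \<times> nat) ell2"
  is "\<lambda>s i j \<xi> (t, k). if k = i then \<xi> (- s + t, j) else 0"
proof -
  fix s :: 'g and i j :: nat and \<xi> :: "'g \<times> nat \<Rightarrow> complex"
  assume "(\<lambda>i. (cmod (\<xi> i))\<^sup>2) summable_on UNIV"
  then show "(\<lambda>p. (cmod (case p of (t, k) \<Rightarrow> if k = i then \<xi> (- s + t, j) else 0))\<^sup>2)
      summable_on UNIV"
    by (auto intro!: ell2_dominated(1)[where f = \<xi> and \<sigma> = "\<lambda>(t, k). (- s + t, j)"
          and A = "UNIV \<times> {i}" and B = 1] simp: inj_on_def split: if_splits)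
qed

lift_definition mat_unit_op :: "'g::group_add \<Rightarrow> nat \<Rightarrow> nat \<Rightarrow> ('g \<times> nat) ell2 \<Rightarrow>\<^sub>L ('g \<times> nat) ell2"
  is mat_unit_ell2
proof (rule bounded_linear_intro)
  fix s :: 'g and i j :: nat and r and \<xi> \<eta> :: "('g \<times> nat) ell2"
  show "mat_unit_ell2 s i j (\<xi> + \<eta>) = mat_unit_ell2 s i j \<xi> + mat_unit_ell2 s i j \<eta>"
    by transfer auto
  show "mat_unit_ell2 s i j (r *\<^sub>R \<xi>) = r *\<^sub>R mat_unit_ell2 s i j \<xi>"
    by transfer auto
  show "norm (mat_unit_ell2 s i j \<xi>) \<le> norm \<xi> * 1"
    by (rule norm_ell2_dominated[where \<sigma> = "\<lambda>(t, k). (- s + t, j)" and A = "UNIV \<times> {i}"])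
      (auto simp: mat_unit_ell2.rep_eq inj_on_def split: if_splits)
qed

text \<open>\<open>mat_group_sum n S a\<close> is \<open>\<Sum>\<^bsub>s \<in> S\<^esub> \<lambda>\<^sub>s \<otimes> a\<^sub>s\<close>, an element of \<open>M\<^sub>n(\<complex>[\<Gamma>])\<close>.\<close>

definition mat_group_sum ::
    "nat \<Rightarrow> 'g::group_add set \<Rightarrow> ('g \<Rightarrow> nat \<Rightarrow> nat \<Rightarrow> complex) \<Rightarrow> ('g \<times> nat) ell2 \<Rightarrow>\<^sub>L ('g \<times> nat) ell2" where
  "mat_group_sum n S a = (\<Sum>s\<in>S. \<Sum>i<n. \<Sum>j<n. cop_scale (a s i j) (mat_unit_op s i j))"

text \<open>The map \<open>\<lambda>\<^sub>s \<mapsto> u(s) \<lambda>\<^sub>s\<close> on \<open>C\<^sup>*\<^sub>r(\<Gamma>)\<close> is completely bounded with cb-norm at most \<open>C\<close>.\<close>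

definition cb_multiplier_bound :: "('g::group_add \<Rightarrow> complex) \<Rightarrow> real \<Rightarrow> bool" where
  "cb_multiplier_bound u C \<longleftrightarrow> 0 \<le> C \<and>
     (\<forall>n S a. finite S \<longrightarrow>
        norm (mat_group_sum n S (\<lambda>s i j. u s * a s i j)) \<le> C * norm (mat_group_sum n S a))"

definition cb_multipliers :: "('g::group_add \<Rightarrow> complex) set" where
  "cb_multipliers = {u. \<exists>C. cb_multiplier_bound u C}"

definition cb_norm :: "('g::group_add \<Rightarrow> complex) \<Rightarrow> real" where
  "cb_norm u = Inf {C. cb_multiplier_bound u C}"

text \<open>
  \<open>Q(\<Gamma>)\<close>, as the norm closure of \<open>\<ell>\<^sup>1(\<Gamma>)\<close> in the dual of \<open>M\<^sub>0A(\<Gamma>)\<close>.  Only the values of \<open>\<omega>\<close> on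
  \<open>cb_multipliers\<close> matter; there, \<open>\<omega>\<close> is automatically linear and bounded.
\<close>

definition cb_predual :: "(('g::group_add \<Rightarrow> complex) \<Rightarrow> complex) set" where
  "cb_predual = {\<omega>. \<forall>\<epsilon>>0. \<exists>\<phi>. (\<lambda>g. cmod (\<phi> g)) summable_on UNIV \<and>
     (\<forall>u\<in>cb_multipliers. cmod (\<omega> u - (\<Sum>\<^sub>\<infinity>g. \<phi> g * u g)) \<le> \<epsilon> * cb_norm u)}"

text \<open>A net of finitely supported functions is represented by the filter that it generates.\<close>

definition approximation_property :: "'g::group_add itself \<Rightarrow> bool" where
  "approximation_property _ \<longleftrightarrow>
     (\<exists>F :: ('g \<Rightarrow> complex) filter. F \<noteq> bot \<and> (\<forall>\<^sub>F f in F. finite {g. f g \<noteq> 0}) \<and>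
        (\<forall>\<omega>\<in>cb_predual. (\<omega> \<longlongrightarrow> \<omega> (\<lambda>_. 1)) F))"

lemma cb_norm_nonneg:
  assumes "u \<in> cb_multipliers"
  shows "0 \<le> cb_norm u"
  unfolding cb_norm_def
proof (rule cInf_greatest)
  show "{C. cb_multiplier_bound u C} \<noteq> {}"
    using assms unfolding cb_multipliers_def by blast
  show "0 \<le> C" if "C \<in> {C. cb_multiplier_bound u C}" for C
    using that unfolding cb_multiplier_bound_def by blast
qed

lemma l1_in_cb_predual:
  fixes \<phi> :: "'g::group_add \<Rightarrow> complex"
  assumes "(\<lambda>g. cmod (\<phi> g)) summable_on UNIV"
  shows "(\<lambda>u. \<Sum>\<^sub>\<infinity>g. \<phi> g * u g) \<in> cb_predual"
  unfolding cb_predual_def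
proof (intro CollectI allI impI exI[of _ \<phi>] conjI ballI assms)
  fix \<epsilon> :: real and u :: "'g \<Rightarrow> complex"
  assume "0 < \<epsilon>" "u \<in> cb_multipliers"
  then show "cmod ((\<Sum>\<^sub>\<infinity>g. \<phi> g * u g) - (\<Sum>\<^sub>\<infinity>g. \<phi> g * u g)) \<le> \<epsilon> * cb_norm u"
    by (simp add: cb_norm_nonneg)
qed

lemma approximation_property_l1:
  assumes "approximation_property TYPE('g::group_add)"
  obtains F :: "('g::group_add \<Rightarrow> complex) filter"
  where "F \<noteq> bot" "\<forall>\<^sub>F f in F. finite {g. f g \<noteq> 0}"
    "\<And>\<phi>. (\<lambda>g. cmod (\<phi> g)) summable_on UNIV \<Longrightarrow>
      ((\<lambda>f. \<Sum>\<^sub>\<infinity>g. \<phi> g * f g) \<longlongrightarrow> (\<Sum>\<^sub>\<infinity>g. \<phi> g)) F"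
proof -
  from assms obtain F :: "('g \<Rightarrow> complex) filter" where F: "F \<noteq> bot"
      "\<forall>\<^sub>F f in F. finite {g. f g \<noteq> 0}" "\<forall>\<omega>\<in>cb_predual. (\<omega> \<longlongrightarrow> \<omega> (\<lambda>_. 1)) F"
    unfolding approximation_property_def by blast
  show thesis
  proof (rule that[OF F(1,2)])
    fix \<phi> :: "'g \<Rightarrow> complex"
    assume "(\<lambda>g. cmod (\<phi> g)) summable_on UNIV"
    from bspec[OF F(3) l1_in_cb_predual[OF this]]
    show "((\<lambda>f. \<Sum>\<^sub>\<infinity>g. \<phi> g * f g) \<longlongrightarrow> (\<Sum>\<^sub>\<infinity>g. \<phi> g)) F"
      by simp
  qed
qed

end

theory Submission
  imports Defs
begin

text \<open>
  An operator \<open>T\<close> in the reduced crossed product has Fourier coefficients \<open>E\<^sub>g(T) \<in> C(X)\<close>, of norm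
  at most \<open>\<parallel>T\<parallel>\<close>, with \<open>T = \<Sum> E\<^sub>g(T) u\<^sub>g\<close> if \<open>T\<close> is a finite sum of monomials \<open>f u\<^sub>g\<close>.  The inverse of
  \<open>U \<mapsto> bimodule_of act U\<close> sends a bimodule \<open>M\<close> to its support, the set of all \<open>(g, x)\<close> for which some
  \<open>T \<in> M\<close> has \<open>E\<^sub>g(T)(x) \<noteq> 0\<close>.

  That \<open>U\<close> is the support of its own bimodule follows from Urysohn's lemma and the continuity of the
  coefficients (\<open>bimodule_support_bimodule_of\<close>).  Conversely, let \<open>M\<close> be a closed bimodule with
  support \<open>U\<close>.  Two inclusions are needed, and each consumes one of the two main hypotheses.

  \<^item> \<open>bimodule_of act U \<subseteq> M\<close> uses freeness.  Let \<open>R\<close> be a finite sum of monomials \<open>f u\<^sub>h\<close>.  There are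
    continuous \<open>p\<^sub>i\<close> with \<open>\<Sum> p\<^sub>i\<^sup>2 = 1\<close> whose supports are so small that each of the finitely many
    \<open>g h\<inverse> \<noteq> e\<close> moves them off themselves.  The contraction \<open>T \<mapsto> \<Sum> p\<^sub>i T (p\<^sub>i \<circ> g)\<close> then sends \<open>R\<close> to
    \<open>E\<^sub>g(R) u\<^sub>g\<close>, while it maps \<open>M\<close> into \<open>M\<close>.  Approximating \<open>T \<in> M\<close> by such \<open>R\<close> gives \<open>E\<^sub>g(T) u\<^sub>g \<in> M\<close>
    (\<open>bimodule_contains_fourier_terms\<close>).  The functions \<open>f\<close> with \<open>f u\<^sub>g \<in> M\<close> form a closed ideal of
    \<open>C(X)\<close>, hence comprise all functions that vanish off the corresponding slice of \<open>U\<close>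
    (\<open>bimodule_contains_supported_terms\<close>).

  \<^item> \<open>M \<subseteq> bimodule_of act U\<close> uses the approximation property, in the form that \<open>T\<close> belongs to every closed
    subspace \<open>V\<close> containing all \<open>E\<^sub>g(T) u\<^sub>g\<close> (\<open>fourier_synthesis\<close>).  A completely bounded multiplier \<open>u\<close>
    is a Schur multiplier on matrices indexed by the group (\<open>cb_multiplier_schur_bound\<close>), so
    \<open>M\<^sub>u : \<Sum> f\<^sub>g u\<^sub>g \<mapsto> \<Sum> u(g) f\<^sub>g u\<^sub>g\<close> has norm at most \<open>cb_norm u\<close> on finite sums (\<open>norm_multiplier_le\<close>).
    If \<open>T \<notin> V\<close>, the Hahn-Banach theorem provides a bounded functional \<open>\<psi>\<close> that vanishes on \<open>V\<close> but not
    at \<open>T\<close>.  Then \<open>\<omega>(u) = \<psi>(M\<^sub>u T)\<close> is an element of the predual, because it is approximated by the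
    functionals \<open>u \<mapsto> \<psi>(M\<^sub>u R)\<close> for finite sums \<open>R\<close> near \<open>T\<close>.  It vanishes on all finitely supported
    \<open>u\<close>, whereas \<open>\<omega>(1) = \<psi>(T) \<noteq> 0\<close>; this contradicts the approximation property.
\<close>

section \<open>Separation of a point from a closed subspace\<close>

definition sublinear :: "('a::real_vector \<Rightarrow> real) \<Rightarrow> bool" where
  "sublinear p \<longleftrightarrow> (\<forall>x y. p (x + y) \<le> p x + p y) \<and> (\<forall>r x. 0 \<le> r \<longrightarrow> p (r *\<^sub>R x) = r * p x)"

lemma sublinearI:
  assumes "\<And>x y. p (x + y) \<le> p x + p y" "p 0 = 0" "\<And>r x. 0 < r \<Longrightarrow> p (r *\<^sub>R x) \<le> r * p x"
  shows "sublinear p"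
  unfolding sublinear_def
proof (intro conjI allI impI)
  fix r :: real and x
  assume "0 \<le> r"
  show "p (r *\<^sub>R x) = r * p x"
  proof (cases "r = 0")
    case False
    with \<open>0 \<le> r\<close> have r: "0 < r" by simp
    then have "p (inverse r *\<^sub>R (r *\<^sub>R x)) \<le> inverse r * p (r *\<^sub>R x)"
      by (intro assms(3)) simp
    then have "r * p x \<le> p (r *\<^sub>R x)"
      using r by (simp add: field_simps)
    with assms(3)[OF r] show ?thesis by (simp add: antisym)
  qed (simp add: assms(2))
qed (rule assms(1))

lemma sublinearD:
  assumes "sublinear p"
  shows "p (x + y) \<le> p x + p y" "0 \<le> r \<Longrightarrow> p (r *\<^sub>R x) = r * p x" "p 0 = 0" "- p (- x) \<le> p x"
proof -
  have add: "p (x + y) \<le> p x + p y" for x y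
    using assms unfolding sublinear_def by blast
  then show "p (x + y) \<le> p x + p y" .
  show "p (r *\<^sub>R x) = r * p x" if "0 \<le> r"
    using assms that unfolding sublinear_def by blast
  show z: "p 0 = 0"
    using assms unfolding sublinear_def by (metis mult_zero_left order_refl scaleR_zero_left)
  show "- p (- x) \<le> p x"
    using add[of x "- x"] z by simp
qed

text \<open>
  The witness is \<open>q(y) = inf {p(y + t x) - t p(x) | t \<ge> 0}\<close>, which is bounded below by \<open>- p(- y)\<close>; the
  parameter \<open>t = 1\<close> gives the value at \<open>- x\<close>.  The lemma serves twice: it shows that a minimal
  sublinear functional is odd, hence linear, and it forces a functional below \<open>q\<close> to be at least
  \<open>p(x)\<close> at \<open>x\<close>.
\<close>

lemma sublinear_lower:
  fixes p :: "'a::real_vector \<Rightarrow> real"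
  assumes p: "sublinear p"
  obtains q where "sublinear q" "q \<le> p" "q (- x) \<le> - p x"
proof
  define h where "h y t = p (y + t *\<^sub>R x) - t * p x" for y t
  define q where "q y = (INF t\<in>{0..}. h y t)" for y
  have lb: "- p (- y) \<le> h y t" if "0 \<le> t" for y t
    using sublinearD(1)[OF p, of "y + t *\<^sub>R x" "- y"] sublinearD(2)[OF p that, of x]
    unfolding h_def by simp
  have bdd: "bdd_below (h y ` {0..})" for y
    using lb by (intro bdd_belowI[of _ "- p (- y)"]) auto
  have le: "q y \<le> h y t" if "0 \<le> t" for y t
    unfolding q_def by (rule cINF_lower[OF bdd]) (use that in auto)
  show "q \<le> p"
    using le[of 0] by (auto simp: le_fun_def h_def)
  show "q (- x) \<le> - p x"
    using le[of 1 "- x"] sublinearD(3)[OF p] by (simp add: h_def)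
  show "sublinear q"
  proof (rule sublinearI)
    fix y z
    have *: "q (y + z) \<le> h y s + h z t" if "0 \<le> s" "0 \<le> t" for s t
    proof -
      have "q (y + z) \<le> h (y + z) (s + t)"
        using that by (intro le) simp
      also have "\<dots> \<le> h y s + h z t"
        using sublinearD(1)[OF p, of "y + s *\<^sub>R x" "z + t *\<^sub>R x"]
        unfolding h_def by (simp add: algebra_simps)
      finally show ?thesis .
    qed
    have "q (y + z) - h y s \<le> q z" if "0 \<le> s" for s
      unfolding q_def[of z] using *[OF that] by (intro cINF_greatest) (auto simp: algebra_simps)
    then have "q (y + z) - q z \<le> q y"
      unfolding q_def[of y] by (intro cINF_greatest) (auto simp: algebra_simps)
    then show "q (y + z) \<le> q y + q z" by simp
  next
    have "h 0 t = 0" if "0 \<le> t" for t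
      using sublinearD(2)[OF p that] by (simp add: h_def)
    then have "h 0 ` {0..} = {0}" by force
    then show "q 0 = 0"
      unfolding q_def by simp
  next
    fix r :: real and y
    assume r: "0 < r"
    have "inverse r * q (r *\<^sub>R y) \<le> q y"
      unfolding q_def[of y]
    proof (rule cINF_greatest)
      fix t :: real
      assume t: "t \<in> {0..}"
      have "q (r *\<^sub>R y) \<le> h (r *\<^sub>R y) (r * t)"
        using r t by (intro le) simp
      also have "\<dots> = r * h y t"
        using sublinearD(2)[OF p, of r "y + t *\<^sub>R x"] r by (simp add: h_def algebra_simps)
      finally show "inverse r * q (r *\<^sub>R y) \<le> h y t"
        using r by (simp add: field_simps)
    qed simp
    then show "q (r *\<^sub>R y) \<le> r * q y"
      using r by (simp add: field_simps)
  qed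
qed

lemma sublinear_chain_Inf:
  fixes C :: "('a::real_vector \<Rightarrow> real) set"
  assumes C: "C \<noteq> {}" "\<And>q. q \<in> C \<Longrightarrow> sublinear q" "\<And>q. q \<in> C \<Longrightarrow> q \<le> p"
    and chain: "\<And>q r. q \<in> C \<Longrightarrow> r \<in> C \<Longrightarrow> q \<le> r \<or> r \<le> q"
  obtains u where "sublinear u" "\<And>q. q \<in> C \<Longrightarrow> u \<le> q"
proof
  define u where "u x = (INF q\<in>C. q x)" for x
  have lb: "- p (- x) \<le> q x" if "q \<in> C" for q x
    using sublinearD(4)[OF C(2)[OF that], of x] le_funD[OF C(3)[OF that], of "- x"] by simp
  have le: "u x \<le> q x" if "q \<in> C" for x q
    unfolding u_def using that lb by (intro cINF_lower bdd_belowI[of _ "- p (- x)"]) auto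
  then show "u \<le> q" if "q \<in> C" for q
    using that by (simp add: le_fun_def)
  show "sublinear u"
  proof (rule sublinearI)
    fix x y
    have *: "u (x + y) \<le> q x + r y" if qr: "q \<in> C" "r \<in> C" for q r
    proof -
      obtain m where m: "m \<in> C" "m \<le> q" "m \<le> r"
        using chain[OF qr] qr by blast
      have "u (x + y) \<le> m x + m y"
        using le[OF m(1)] sublinearD(1)[OF C(2)[OF m(1)], of x y] by (rule order_trans)
      also have "\<dots> \<le> q x + r y"
        by (intro add_mono le_funD[OF m(2)] le_funD[OF m(3)])
      finally show ?thesis .
    qed
    have "u (x + y) - q x \<le> u y" if "q \<in> C" for q
      unfolding u_def[of y] using *[OF that] C(1)
      by (intro cINF_greatest) (auto simp: algebra_simps)
    then have "u (x + y) - u y \<le> u x"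
      unfolding u_def[of x] using C(1) by (intro cINF_greatest) (auto simp: algebra_simps)
    then show "u (x + y) \<le> u x + u y" by simp
  next
    have "(\<lambda>q. q 0) ` C = {0}"
      using C(1) sublinearD(3)[OF C(2)] by force
    then show "u 0 = 0"
      unfolding u_def by simp
  next
    fix r :: real and x
    assume r: "0 < r"
    have "inverse r * u (r *\<^sub>R x) \<le> u x"
      unfolding u_def[of x]
    proof (rule cINF_greatest[OF C(1)])
      fix q assume q: "q \<in> C"
      have "u (r *\<^sub>R x) \<le> r * q x"
        using le[OF q, of "r *\<^sub>R x"] sublinearD(2)[OF C(2)[OF q], of r x] r by simp
      then show "inverse r * u (r *\<^sub>R x) \<le> q x"
        using r by (simp add: field_simps)
    qed
    then show "u (r *\<^sub>R x) \<le> r * u x"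
      using r by (simp add: field_simps)
  qed
qed

text \<open>
  By Zorn's lemma there is a minimal sublinear functional below \<open>p\<close>.  Lowering it in the direction
  \<open>x\<close> leaves it unchanged, so it is odd; a sublinear odd functional is linear.
\<close>

lemma linear_below_sublinear:
  fixes p :: "'a::real_vector \<Rightarrow> real"
  assumes p: "sublinear p"
  obtains f where "linear f" "f \<le> p"
proof -
  define A where "A = {q. sublinear q \<and> q \<le> p}"
  define P where "P q r \<longleftrightarrow> r \<le> q" for q r :: "'a \<Rightarrow> real"
  have "\<exists>m\<in>A. \<forall>q\<in>A. P m q \<longrightarrow> q = m"
  proof (rule predicate_Zorn)
    show "partial_order_on A (relation_of P A)"
      by (rule partial_order_on_relation_ofI) (auto simp: P_def)
    fix C assume C: "C \<in> Chains (relation_of P A)"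
    then have sub: "C \<subseteq> A" and ch: "\<And>q r. q \<in> C \<Longrightarrow> r \<in> C \<Longrightarrow> q \<le> r \<or> r \<le> q"
      unfolding Chains_def relation_of_def P_def by auto
    show "\<exists>u\<in>A. \<forall>q\<in>C. P q u"
    proof (cases "C = {}")
      case True
      then show ?thesis using p by (auto simp: A_def)
    next
      case False
      obtain u where u: "sublinear u" "\<And>q. q \<in> C \<Longrightarrow> u \<le> q"
        using sublinear_chain_Inf[OF False, of p] sub ch unfolding A_def by blast
      moreover have "u \<le> p"
        using False u(2) sub unfolding A_def by (blast intro: order_trans)
      ultimately show ?thesis by (auto simp: A_def P_def)
    qed
  qed
  then obtain m where m: "sublinear m" "m \<le> p"
      and min: "\<And>q. sublinear q \<Longrightarrow> q \<le> m \<Longrightarrow> q = m"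
    unfolding A_def P_def by (auto intro: order_trans)
  have neg: "m (- x) = - m x" for x
  proof -
    obtain q where "sublinear q" "q \<le> m" "q (- x) \<le> - m x"
      using sublinear_lower[OF m(1)] by blast
    with min have "m (- x) \<le> - m x" by blast
    with sublinearD(4)[OF m(1), of x] show ?thesis by simp
  qed
  have "linear m"
  proof (rule linearI)
    fix x y
    show "m (x + y) = m x + m y"
      using sublinearD(1)[OF m(1), of x y] sublinearD(1)[OF m(1), of "- x" "- y"] neg[of "x + y"]
      by (simp add: neg)
  next
    fix r :: real and x
    show "m (r *\<^sub>R x) = r *\<^sub>R m x"
    proof (cases "0 \<le> r")
      case False
      then show ?thesis
        using sublinearD(2)[OF m(1), of "- r" x] neg[of "r *\<^sub>R x"] by simp
    qed (simp add: sublinearD(2)[OF m(1)])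
  qed
  then show thesis using m(2) by (rule that)
qed

lemma sublinear_infdist:
  fixes B :: "'a::real_normed_vector set"
  assumes B: "subspace B"
  shows "sublinear (\<lambda>x. infdist x B)"
proof (rule sublinearI)
  have ne: "B \<noteq> {}" using subspace_0[OF B] by blast
  fix x y :: 'a
  have *: "infdist (x + y) B \<le> dist x b + dist y c" if "b \<in> B" "c \<in> B" for b c
  proof -
    have "infdist (x + y) B \<le> dist (x + y) (b + c)"
      using subspace_add[OF B that] by (rule infdist_le)
    also have "\<dots> \<le> dist x b + dist y c"
      by (rule dist_triangle_add)
    finally show ?thesis .
  qed
  have "infdist (x + y) B - dist x b \<le> infdist y B" if "b \<in> B" for b
    unfolding infdist_notempty[OF ne, of y] using *[OF that] ne
    by (intro cINF_greatest) (auto simp: algebra_simps)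
  then have "infdist (x + y) B - infdist y B \<le> infdist x B"
    unfolding infdist_notempty[OF ne, of x] using ne
    by (intro cINF_greatest) (auto simp: algebra_simps)
  then show "infdist (x + y) B \<le> infdist x B + infdist y B" by simp
next
  show "infdist 0 B = 0"
    using subspace_0[OF B] by simp
next
  have ne: "B \<noteq> {}" using subspace_0[OF B] by blast
  fix r :: real and x :: 'a
  assume r: "0 < r"
  have "inverse r * infdist (r *\<^sub>R x) B \<le> infdist x B"
    unfolding infdist_notempty[OF ne, of x]
  proof (rule cINF_greatest[OF ne])
    fix b assume "b \<in> B"
    then have "infdist (r *\<^sub>R x) B \<le> dist (r *\<^sub>R x) (r *\<^sub>R b)"
      by (intro infdist_le subspace_mul[OF B])
    also have "\<dots> = r * dist x b"
      using r by (simp add: dist_norm flip: scaleR_diff_right)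
    finally show "inverse r * infdist (r *\<^sub>R x) B \<le> dist x b"
      using r by (simp add: field_simps)
  qed
  then show "infdist (r *\<^sub>R x) B \<le> r * infdist x B"
    using r by (simp add: field_simps)
qed

text \<open>
  Lower the sublinear functional \<open>infdist _ B\<close> in the direction \<open>x\<close> and take a linear functional \<open>f\<close>
  below the result.  It vanishes on \<open>B\<close>, is bounded by the norm, and \<open>f x\<close> is at least the distance
  from \<open>x\<close> to \<open>B\<close>.
\<close>

lemma closed_subspace_separation:
  fixes B :: "'a::real_normed_vector set"
  assumes B: "subspace B" "closed B" and x: "x \<notin> B"
  obtains f :: "'a \<Rightarrow> real" where "bounded_linear f" "\<And>b. b \<in> B \<Longrightarrow> f b = 0" "f x \<noteq> 0"
proof -
  let ?p = "\<lambda>y. infdist y B"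
  have ne: "B \<noteq> {}" using subspace_0[OF B(1)] by blast
  obtain q where q: "sublinear q" "q \<le> ?p" "q (- x) \<le> - ?p x"
    using sublinear_lower[OF sublinear_infdist[OF B(1)]] by blast
  obtain f where f: "linear f" "f \<le> q"
    using linear_below_sublinear[OF q(1)] by blast
  have le: "f y \<le> infdist y B" for y
    using le_funD[OF f(2), of y] le_funD[OF q(2), of y] by linarith
  have 0: "f b = 0" if "b \<in> B" for b
    using le[of b] le[of "- b"] that subspace_neg[OF B(1) that] linear_neg[OF f(1), of b] by simp
  have nrm: "f y \<le> norm y" for y
    using le[of y] infdist_le[OF subspace_0[OF B(1)], of y] by simp
  have "bounded_linear f"
  proof (intro bounded_linear.intro bounded_linear_axioms.intro f(1) exI[of _ 1] allI)
    show "norm (f y) \<le> norm y * 1" for y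
      using nrm[of y] nrm[of "- y"] linear_neg[OF f(1), of y] by simp
  qed
  moreover have "0 < infdist x B"
    using in_closed_iff_infdist_zero[OF B(2) ne, of x] x infdist_nonneg[of x B] by linarith
  then have "f (- x) < 0"
    using le_funD[OF f(2), of "- x"] q(3) by linarith
  then have "f x \<noteq> 0"
    using linear_neg[OF f(1), of x] by linarith
  ultimately show thesis using 0 that by blast
qed

section \<open>Coordinates of vectors and operators\<close>

lemma ell2_eqI: "(\<And>i. Rep_ell2 x i = Rep_ell2 y i) \<Longrightarrow> x = y"
  by (simp add: Rep_ell2_inject[symmetric] fun_eq_iff)

lemma Rep_ell2_sum: "Rep_ell2 (\<Sum>s\<in>S. f s) i = (\<Sum>s\<in>S. Rep_ell2 (f s) i)"
  by (induction S rule: infinite_finite_induct) (simp_all add: plus_ell2.rep_eq zero_ell2.rep_eq)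

lemma Rep_ell2_diff: "Rep_ell2 (x - y) i = Rep_ell2 x i - Rep_ell2 y i"
  unfolding minus_ell2_def plus_ell2.rep_eq uminus_ell2.rep_eq by simp

lemma sum_le_norm_ell2:
  assumes "finite F"
  shows "(\<Sum>i\<in>F. (cmod (Rep_ell2 x i))\<^sup>2) \<le> (norm x)\<^sup>2"
proof -
  have s: "(\<lambda>i. (cmod (Rep_ell2 x i))\<^sup>2) summable_on UNIV" using Rep_ell2[of x] by simp
  have "(\<Sum>i\<in>F. (cmod (Rep_ell2 x i))\<^sup>2) \<le> (\<Sum>\<^sub>\<infinity>i. (cmod (Rep_ell2 x i))\<^sup>2)"
    using s assms by (rule finite_sum_le_infsum) auto
  then show ?thesis
    by (simp add: norm_ell2_eq infsum_nonneg)
qed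

lemma norm_ell2_leI:
  assumes "0 \<le> B" "\<And>F. finite F \<Longrightarrow> (\<Sum>i\<in>F. (cmod (Rep_ell2 x i))\<^sup>2) \<le> B\<^sup>2"
  shows "norm x \<le> B"
proof -
  have "(\<Sum>\<^sub>\<infinity>i. (cmod (Rep_ell2 x i))\<^sup>2) \<le> B\<^sup>2"
    using Rep_ell2[of x] assms(2) by (intro infsum_le_finite_sums) auto
  then show ?thesis
    unfolding norm_ell2_eq using assms(1) by (simp add: real_le_lsqrt)
qed

lemma cmod_Rep_le_norm: "cmod (Rep_ell2 x i) \<le> norm x"
  using sum_le_norm_ell2[of "{i}" x] by simp

definition finite_vec :: "'i set \<Rightarrow> ('i \<Rightarrow> complex) \<Rightarrow> 'i ell2" where
  "finite_vec F z = Abs_ell2 (\<lambda>i. if i \<in> F then z i else 0)"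

lemma Rep_finite_vec:
  assumes "finite F"
  shows "Rep_ell2 (finite_vec F z) i = (if i \<in> F then z i else 0)"
proof -
  have "(\<lambda>i. (cmod (if i \<in> F then z i else 0))\<^sup>2) summable_on F"
    using assms by simp
  then have "(\<lambda>i. (cmod (if i \<in> F then z i else 0))\<^sup>2) summable_on UNIV"
    by (rule summable_on_cong_neutral[THEN iffD1, rotated -1]) auto
  then show ?thesis
    unfolding finite_vec_def by (subst Abs_ell2_inverse) auto
qed

lemma norm_finite_vec:
  assumes "finite F"
  shows "(norm (finite_vec F z))\<^sup>2 = (\<Sum>i\<in>F. (cmod (z i))\<^sup>2)"
proof -
  have "(norm (finite_vec F z))\<^sup>2 = (\<Sum>\<^sub>\<infinity>i. (cmod (Rep_ell2 (finite_vec F z) i))\<^sup>2)"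
    by (simp add: norm_ell2_eq infsum_nonneg)
  also have "\<dots> = (\<Sum>\<^sub>\<infinity>i\<in>F. (cmod (z i))\<^sup>2)"
    by (rule infsum_cong_neutral) (auto simp: Rep_finite_vec[OF assms])
  finally show ?thesis using assms by simp
qed

lemma Rep_cfun_op:
  "Rep_ell2 (blinfun_apply (cfun_op act f) x) (t, y) = apply_bcontfun f (act t y) * Rep_ell2 x (t, y)"
  by (simp add: cfun_op.rep_eq cfun_ell2.rep_eq)

lemma Rep_unitary_op:
  "Rep_ell2 (blinfun_apply (unitary_op g) x) (t, y) = Rep_ell2 x (- g + t, y)"
  by (simp add: unitary_op.rep_eq unitary_ell2.rep_eq)

lemma Rep_cop_scale:
  "Rep_ell2 (blinfun_apply (cop_scale c T) x) i = c * Rep_ell2 (blinfun_apply T x) i"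
  by (simp add: cop_scale_def ell2_scale_op.rep_eq ell2_scale.rep_eq)

lemma Rep_sum_op:
  "Rep_ell2 (blinfun_apply (\<Sum>s\<in>S. T s) x) i = (\<Sum>s\<in>S. Rep_ell2 (blinfun_apply (T s) x) i)"
  by (simp add: blinfun.sum_left Rep_ell2_sum)

lemma cop_eqI: "(\<And>x i. Rep_ell2 (blinfun_apply S x) i = Rep_ell2 (blinfun_apply T x) i) \<Longrightarrow> S = T"
  by (intro blinfun_eqI ell2_eqI)

lemma norm_cop_scale_le: "norm (cop_scale c T) \<le> cmod c * norm T"
proof (rule norm_blinfun_bound)
  fix x
  have "norm (blinfun_apply (cop_scale c T) x) \<le> norm (blinfun_apply T x) * cmod c"
    by (rule norm_ell2_dominated[where \<sigma> = id and A = UNIV]) (auto simp: Rep_cop_scale norm_mult)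
  also have "\<dots> \<le> norm T * norm x * cmod c"
    by (intro mult_right_mono norm_blinfun) auto
  finally show "norm (blinfun_apply (cop_scale c T) x) \<le> cmod c * norm T * norm x"
    by (simp add: algebra_simps)
qed simp

lemma norm_cfun_op_le: "norm (cfun_op act f) \<le> norm f"
proof (rule norm_blinfun_bound)
  fix x
  have "norm (blinfun_apply (cfun_op act f) x) \<le> norm x * norm f"
    by (rule norm_ell2_dominated[where \<sigma> = id and A = UNIV])
      (auto simp: Rep_cfun_op norm_mult intro!: mult_right_mono norm_bounded)
  then show "norm (blinfun_apply (cfun_op act f) x) \<le> norm f * norm x" by (simp add: mult.commute)
qed simp

lemma norm_unitary_op_le: "norm (unitary_op g) \<le> 1"
proof (rule norm_blinfun_bound)
  fix x
  have "norm (blinfun_apply (unitary_op g) x) \<le> norm x * 1"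
    by (rule norm_ell2_dominated[where \<sigma> = "\<lambda>(t, x). (- g + t, x)" and A = UNIV])
      (auto simp: Rep_unitary_op inj_on_def)
  then show "norm (blinfun_apply (unitary_op g) x) \<le> 1 * norm x" by simp
qed simp

lemma bounded_linear_cop_scale: "bounded_linear (cop_scale c)"
  unfolding cop_scale_def
  by (rule bounded_bilinear.bounded_linear_right[OF bounded_bilinear_blinfun_compose])

lemma bounded_linear_sandwich: "bounded_linear (\<lambda>T. P o\<^sub>L T o\<^sub>L Q)"
  using bounded_linear_compose[where f = "\<lambda>T. T o\<^sub>L Q" and g = "\<lambda>T. P o\<^sub>L T"]
    bounded_bilinear.bounded_linear_left[OF bounded_bilinear_blinfun_compose, of Q]
    bounded_bilinear.bounded_linear_right[OF bounded_bilinear_blinfun_compose, of P]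
  by blast

lemma closure_mapped_into:
  assumes "bounded_linear f" "\<And>x. x \<in> V \<Longrightarrow> f x \<in> closure W" "x \<in> closure V"
  shows "f x \<in> closure W"
proof -
  have "f ` closure V \<subseteq> closure W"
    using linear_continuous_on[OF assms(1)] closed_closure
    by (rule image_closure_subset) (use assms(2) in auto)
  with assms(3) show ?thesis by auto
qed

lemma cop_subspace_closure:
  assumes V: "cop.subspace V"
  shows "cop.subspace (closure V)"
proof (rule cop.subspaceI)
  show "0 \<in> closure V"
    by (rule subsetD[OF closure_subset cop.subspace_0[OF V]])
next
  fix x y assume "x \<in> closure V" "y \<in> closure V"
  then obtain a b where ab: "\<forall>n. a n \<in> V" "a \<longlonglongrightarrow> x" "\<forall>n. b n \<in> V" "b \<longlonglongrightarrow> y"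
    unfolding closure_sequential by blast
  then have "(\<lambda>n. a n + b n) \<longlonglongrightarrow> x + y" by (intro tendsto_add)
  with ab cop.subspace_add[OF V] show "x + y \<in> closure V"
    unfolding closure_sequential by (intro exI[of _ "\<lambda>n. a n + b n"]) simp
next
  fix c x assume x: "x \<in> closure V"
  have "cop_scale c y \<in> closure V" if "y \<in> V" for y
    by (rule subsetD[OF closure_subset cop.subspace_scale[OF V that]])
  from bounded_linear_cop_scale this x show "cop_scale c x \<in> closure V"
    by (rule closure_mapped_into)
qed

lemma cop_scale_of_real: "cop_scale (of_real r) T = r *\<^sub>R T"
  by (rule cop_eqI) (simp add: Rep_cop_scale blinfun.scaleR_left scaleR_ell2.rep_eq scaleR_conv_of_real)

lemma cop_subspace_imp_subspace:
  assumes "cop.subspace V"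
  shows "subspace V"
proof (rule subspaceI)
  show "r *\<^sub>R x \<in> V" if "x \<in> V" for r x
    using cop.subspace_scale[OF assms that, of "of_real r"] by (simp add: cop_scale_of_real)
qed (use cop.subspace_0[OF assms] cop.subspace_add[OF assms] in auto)

section \<open>Completely bounded multipliers as Schur multipliers\<close>

lemma Rep_mat_unit_op:
  "Rep_ell2 (blinfun_apply (mat_unit_op s i j) x) (t, k) = (if k = i then Rep_ell2 x (- s + t, j) else 0)"
  by (simp add: mat_unit_op.rep_eq mat_unit_ell2.rep_eq)

text \<open>
  The element \<open>\<Sum> a\<^sub>i\<^sub>j \<lambda>(t\<^sub>i - t\<^sub>j) \<otimes> e\<^sub>i\<^sub>j\<close> of \<open>M\<^sub>n(\<complex>[\<Gamma>])\<close>.  Conjugation with the diagonal unitary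
  with entries \<open>\<lambda>(t\<^sub>i)\<close> turns it into \<open>1 \<otimes> a\<close>, so its norm is that of the scalar matrix \<open>a\<close>.  A
  multiplier \<open>u\<close> acts on it by multiplying \<open>a\<^sub>i\<^sub>j\<close> with \<open>u(t\<^sub>i - t\<^sub>j)\<close>.
\<close>

definition ampliation :: "nat \<Rightarrow> (nat \<Rightarrow> 'g::group_add) \<Rightarrow> (nat \<Rightarrow> nat \<Rightarrow> complex) \<Rightarrow>
    ('g \<times> nat) ell2 \<Rightarrow>\<^sub>L ('g \<times> nat) ell2" where
  "ampliation n t a = mat_group_sum n ((\<lambda>(i, j). t i - t j) ` ({..<n} \<times> {..<n}))
     (\<lambda>s i j. if s = t i - t j then a i j else 0)"

lemma Rep_ampliation:
  "Rep_ell2 (blinfun_apply (ampliation n t a) x) (r, k) =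
     (if k < n then \<Sum>j<n. a k j * Rep_ell2 x (t j + (- t k + r), j) else 0)"
proof -
  let ?S = "(\<lambda>(i, j). t i - t j) ` ({..<n} \<times> {..<n})"
  have swap: "- (t i - t j) + r = t j + (- t i + r)" for i j
    by (metis add.assoc diff_conv_add_uminus minus_diff_eq)
  have "Rep_ell2 (blinfun_apply (ampliation n t a) x) (r, k) =
      (\<Sum>s\<in>?S. \<Sum>i<n. \<Sum>j<n. (if s = t i - t j then a i j else 0) *
        (if k = i then Rep_ell2 x (- s + r, j) else 0))"
    by (simp add: ampliation_def mat_group_sum_def Rep_sum_op Rep_cop_scale Rep_mat_unit_op
        del: minus_diff_eq)
  also have "\<dots> = (\<Sum>i<n. \<Sum>j<n. \<Sum>s\<in>?S. (if s = t i - t j then a i j else 0) *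
        (if k = i then Rep_ell2 x (- s + r, j) else 0))"
    by (subst sum.swap, intro sum.cong refl, rule sum.swap)
  also have "\<dots> = (\<Sum>i<n. \<Sum>j<n. if k = i then a i j * Rep_ell2 x (t j + (- t i + r), j) else 0)"
  proof (intro sum.cong refl)
    fix i j assume ij: "i \<in> {..<n}" "j \<in> {..<n}"
    have "(\<Sum>s\<in>?S. (if s = t i - t j then a i j else 0) *
          (if k = i then Rep_ell2 x (- s + r, j) else 0)) =
        (\<Sum>s\<in>?S. if s = t i - t j then a i j * (if k = i then Rep_ell2 x (- s + r, j) else 0) else 0)"
      by (intro sum.cong) auto
    also have "\<dots> = a i j * (if k = i then Rep_ell2 x (- (t i - t j) + r, j) else 0)"
      using ij by (subst sum.delta) auto
    finally show "(\<Sum>s\<in>?S. (if s = t i - t j then a i j else 0) *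
          (if k = i then Rep_ell2 x (- s + r, j) else 0)) =
        (if k = i then a i j * Rep_ell2 x (t j + (- t i + r), j) else 0)"
      unfolding swap by simp
  qed
  also have "\<dots> = (\<Sum>i<n. if k = i then \<Sum>j<n. a i j * Rep_ell2 x (t j + (- t i + r), j) else 0)"
    by (intro sum.cong) auto
  also have "\<dots> = (if k < n then \<Sum>j<n. a k j * Rep_ell2 x (t j + (- t k + r), j) else 0)"
    by (subst sum.delta') auto
  finally show ?thesis .
qed

text \<open>
  After the substitution \<open>r \<mapsto> t\<^sub>k + r\<close> in the \<open>k\<close>-th component, which is the map \<open>h\<close> of the proof,
  the operator acts on every fibre over \<open>r\<close> as the matrix \<open>a\<close>.
\<close>

lemma norm_ampliation_le:
  assumes K: "0 \<le> K"
    and bd: "\<And>z. (\<Sum>i<n. (cmod (\<Sum>j<n. a i j * z j))\<^sup>2) \<le> K\<^sup>2 * (\<Sum>j<n. (cmod (z j))\<^sup>2)"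
  shows "norm (ampliation n t a) \<le> K"
proof (rule norm_blinfun_bound[OF K])
  fix x
  let ?y = "blinfun_apply (ampliation n t a) x"
  show "norm ?y \<le> K * norm x"
  proof (rule norm_ell2_leI)
    fix F :: "('a \<times> nat) set" assume F: "finite F"
    define R where "R = (\<lambda>(r, k). - t k + r) ` F"
    define h where "h = (\<lambda>(r, k). (t k + r, k))"
    have inj: "inj_on h X" for X
      by (auto simp: inj_on_def h_def)
    have "(\<Sum>p\<in>F. (cmod (Rep_ell2 ?y p))\<^sup>2) = (\<Sum>p\<in>F \<inter> UNIV \<times> {..<n}. (cmod (Rep_ell2 ?y p))\<^sup>2)"
      using F by (intro sum.mono_neutral_right) (auto simp: Rep_ampliation split: if_splits)
    also have "\<dots> \<le> (\<Sum>p\<in>h ` (R \<times> {..<n}). (cmod (Rep_ell2 ?y p))\<^sup>2)"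
    proof (rule sum_mono2)
      show "finite (h ` (R \<times> {..<n}))" using F by (simp add: R_def)
      show "F \<inter> UNIV \<times> {..<n} \<subseteq> h ` (R \<times> {..<n})"
      proof
        fix p assume "p \<in> F \<inter> UNIV \<times> {..<n}"
        then obtain r k where p: "p = (r, k)" "(r, k) \<in> F" "k < n" by auto
        then have "(- t k + r, k) \<in> R \<times> {..<n}" by (force simp: R_def)
        moreover have "h (- t k + r, k) = p" by (simp add: h_def p flip: add.assoc)
        ultimately show "p \<in> h ` (R \<times> {..<n})" by (metis imageI)
      qed
    qed simp
    also have "\<dots> = (\<Sum>(r, k)\<in>R \<times> {..<n}. (cmod (\<Sum>j<n. a k j * Rep_ell2 x (t j + r, j)))\<^sup>2)"
      by (subst sum.reindex[OF inj]) (auto simp: h_def Rep_ampliation simp flip: add.assoc intro!: sum.cong)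
    also have "\<dots> = (\<Sum>r\<in>R. \<Sum>k<n. (cmod (\<Sum>j<n. a k j * Rep_ell2 x (t j + r, j)))\<^sup>2)"
      by (rule sum.cartesian_product[symmetric])
    also have "\<dots> \<le> (\<Sum>r\<in>R. K\<^sup>2 * (\<Sum>j<n. (cmod (Rep_ell2 x (t j + r, j)))\<^sup>2))"
      by (intro sum_mono bd)
    also have "\<dots> = K\<^sup>2 * (\<Sum>(r, j)\<in>R \<times> {..<n}. (cmod (Rep_ell2 x (t j + r, j)))\<^sup>2)"
      unfolding sum_distrib_left[symmetric] sum.cartesian_product ..
    also have "\<dots> = K\<^sup>2 * (\<Sum>p\<in>h ` (R \<times> {..<n}). (cmod (Rep_ell2 x p))\<^sup>2)"
      by (subst sum.reindex[OF inj]) (auto simp: h_def intro!: sum.cong)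
    also have "\<dots> \<le> K\<^sup>2 * (norm x)\<^sup>2"
      using F by (intro mult_left_mono sum_le_norm_ell2) (auto simp: R_def)
    finally show "(\<Sum>p\<in>F. (cmod (Rep_ell2 ?y p))\<^sup>2) \<le> (K * norm x)\<^sup>2"
      by (simp add: power_mult_distrib)
  qed (use K in simp)
qed

text \<open>
  Test the operator on the vector with value \<open>z\<^sub>j\<close> at the single point \<open>(t\<^sub>j, j)\<close>: its image has the
  value \<open>(a z)\<^sub>i\<close> at \<open>(t\<^sub>i, i)\<close>.
\<close>

lemma le_norm_ampliation:
  "(\<Sum>i<n. (cmod (\<Sum>j<n. a i j * z j))\<^sup>2) \<le> (norm (ampliation n t a))\<^sup>2 * (\<Sum>j<n. (cmod (z j))\<^sup>2)"
proof -
  define F where "F = (\<lambda>j. (t j, j)) ` {..<n}"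
  define x where "x = finite_vec F (\<lambda>(r, j). z j)"
  have F: "finite F" and inj: "inj_on (\<lambda>j. (t j, j)) {..<n}"
    by (auto simp: F_def inj_on_def)
  let ?y = "blinfun_apply (ampliation n t a) x"
  have nx: "(norm x)\<^sup>2 = (\<Sum>j<n. (cmod (z j))\<^sup>2)"
    unfolding x_def norm_finite_vec[OF F] by (simp add: F_def sum.reindex[OF inj])
  have y: "Rep_ell2 ?y (t i, i) = (\<Sum>j<n. a i j * z j)" if "i < n" for i
    using that by (simp add: Rep_ampliation x_def Rep_finite_vec[OF F]) (auto simp: F_def intro!: sum.cong)
  have "(\<Sum>i<n. (cmod (\<Sum>j<n. a i j * z j))\<^sup>2) = (\<Sum>p\<in>F. (cmod (Rep_ell2 ?y p))\<^sup>2)"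
    by (simp add: F_def sum.reindex[OF inj] y)
  also have "\<dots> \<le> (norm ?y)\<^sup>2"
    using F by (rule sum_le_norm_ell2)
  also have "\<dots> \<le> (norm (ampliation n t a) * norm x)\<^sup>2"
    by (intro power_mono norm_blinfun) simp
  finally show ?thesis by (simp add: power_mult_distrib nx)
qed

lemma cb_multiplier_ampliation:
  assumes "cb_multiplier_bound u C"
  shows "norm (ampliation n t (\<lambda>i j. u (t i - t j) * a i j)) \<le> C * norm (ampliation n t a)"
proof -
  let ?S = "(\<lambda>(i, j). t i - t j) ` ({..<n} \<times> {..<n})"
  let ?b = "\<lambda>s i j. if s = t i - t j then a i j else 0"
  have eq: "(\<lambda>s i j. if s = t i - t j then u (t i - t j) * a i j else 0) = (\<lambda>s i j. u s * ?b s i j)"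
    by (simp add: fun_eq_iff)
  have "finite ?S" by simp
  then have "norm (mat_group_sum n ?S (\<lambda>s i j. u s * ?b s i j)) \<le> C * norm (mat_group_sum n ?S ?b)"
    by (rule assms[unfolded cb_multiplier_bound_def, THEN conjunct2, rule_format])
  then show ?thesis
    unfolding ampliation_def eq .
qed

text \<open>
  Enumerate \<open>E\<close> as \<open>e 0, \<dots>, e (n - 1)\<close> and apply the multiplier to the ampliation of the matrix \<open>k\<close>: the
  norms before and after are those of \<open>k\<close> and of the Schur product.
\<close>

lemma cb_multiplier_schur_bound:
  fixes u :: "'g::group_add \<Rightarrow> complex"
  assumes u: "cb_multiplier_bound u C" and E: "finite E" and K: "0 \<le> K"
    and bd: "\<And>z. (\<Sum>s\<in>E. (cmod (\<Sum>t\<in>E. k s t * z t))\<^sup>2) \<le> K\<^sup>2 * (\<Sum>t\<in>E. (cmod (z t))\<^sup>2)"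
  shows "(\<Sum>s\<in>E. (cmod (\<Sum>t\<in>E. u (s - t) * k s t * z t))\<^sup>2) \<le> (C * K)\<^sup>2 * (\<Sum>t\<in>E. (cmod (z t))\<^sup>2)"
proof -
  define n where "n = card E"
  obtain e where e: "bij_betw e {..<n} E"
    using ex_bij_betw_nat_finite[OF E] unfolding n_def atLeast0LessThan by blast
  have sumE: "(\<Sum>s\<in>E. h s) = (\<Sum>i<n. h (e i))" for h :: "'g \<Rightarrow> real"
    by (rule sum.reindex_bij_betw[OF e, symmetric])
  have sumE': "(\<Sum>s\<in>E. h s) = (\<Sum>i<n. h (e i))" for h :: "'g \<Rightarrow> complex"
    by (rule sum.reindex_bij_betw[OF e, symmetric])
  let ?a = "\<lambda>i j. k (e i) (e j)"
  have C: "0 \<le> C" using u by (simp add: cb_multiplier_bound_def)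
  have nK: "norm (ampliation n e ?a) \<le> K"
  proof (rule norm_ampliation_le[OF K])
    fix z :: "nat \<Rightarrow> complex"
    have inv: "inv_into {..<n} e (e i) = i" if "i < n" for i
      using e that by (intro inv_into_f_f) (auto simp: bij_betw_def)
    show "(\<Sum>i<n. (cmod (\<Sum>j<n. ?a i j * z j))\<^sup>2) \<le> K\<^sup>2 * (\<Sum>j<n. (cmod (z j))\<^sup>2)"
      using bd[of "\<lambda>t. z (inv_into {..<n} e t)"] unfolding sumE sumE' by (simp add: inv)
  qed
  have "(\<Sum>s\<in>E. (cmod (\<Sum>t\<in>E. u (s - t) * k s t * z t))\<^sup>2) =
      (\<Sum>i<n. (cmod (\<Sum>j<n. (u (e i - e j) * ?a i j) * z (e j)))\<^sup>2)"
    unfolding sumE sumE' ..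
  also have "\<dots> \<le> (norm (ampliation n e (\<lambda>i j. u (e i - e j) * ?a i j)))\<^sup>2 * (\<Sum>j<n. (cmod (z (e j)))\<^sup>2)"
    by (rule le_norm_ampliation)
  also have "\<dots> \<le> (C * K)\<^sup>2 * (\<Sum>j<n. (cmod (z (e j)))\<^sup>2)"
  proof (intro mult_right_mono power_mono sum_nonneg)
    show "norm (ampliation n e (\<lambda>i j. u (e i - e j) * ?a i j)) \<le> C * K"
      using cb_multiplier_ampliation[OF u, of n e ?a] mult_left_mono[OF nK C] by linarith
  qed auto
  finally show ?thesis unfolding sumE sumE' .
qed

text \<open>
  The infimum that defines \<open>cb_norm\<close> is attained, since the bounds form a closed set.
\<close>

lemma cb_multiplier_bound_cb_norm:
  assumes "u \<in> cb_multipliers"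
  shows "cb_multiplier_bound u (cb_norm u)"
proof -
  have ne: "{C. cb_multiplier_bound u C} \<noteq> {}"
    using assms unfolding cb_multipliers_def by blast
  have "norm (mat_group_sum n S (\<lambda>s i j. u s * a s i j)) \<le> cb_norm u * norm (mat_group_sum n S a)"
    (is "?l \<le> _ * ?r") if S: "finite S" for n S a
  proof (cases "?r = 0")
    case True
    obtain C where "cb_multiplier_bound u C" using ne by blast
    with S have "?l \<le> C * ?r" unfolding cb_multiplier_bound_def by blast
    with True show ?thesis by simp
  next
    case False
    then have r: "0 < ?r" by simp
    have "?l / ?r \<le> cb_norm u"
      unfolding cb_norm_def
    proof (rule cInf_greatest[OF ne])
      fix C assume "C \<in> {C. cb_multiplier_bound u C}"
      with S have "?l \<le> C * ?r" unfolding cb_multiplier_bound_def by blast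
      with r show "?l / ?r \<le> C" by (simp add: field_simps)
    qed
    with r show ?thesis by (simp add: field_simps)
  qed
  with cb_norm_nonneg[OF assms] show ?thesis
    unfolding cb_multiplier_bound_def by blast
qed

section \<open>Fourier coefficients in the reduced crossed product\<close>

locale compact_action =
  fixes act :: "'g::group_add \<Rightarrow> 'x::t2_space \<Rightarrow> 'x"
  assumes compact_space: "compact (UNIV :: 'x set)"
    and homeos: "action_by_homeos act"
begin

abbreviation monomial :: "('x \<Rightarrow>\<^sub>C complex) \<Rightarrow> 'g \<Rightarrow> ('g \<times> 'x) ell2 \<Rightarrow>\<^sub>L ('g \<times> 'x) ell2" where
  "monomial f g \<equiv> cfun_op act f o\<^sub>L unitary_op g"

abbreviation algebraic_crossed_product :: "(('g \<times> 'x) ell2 \<Rightarrow>\<^sub>L ('g \<times> 'x) ell2) set" where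
  "algebraic_crossed_product \<equiv> cop.span {monomial f g | f g. True}"

lemma act_zero [simp]: "act 0 x = x"
  and act_add: "act (g + h) x = act g (act h x)"
  using homeos by (auto simp: action_by_homeos_def)

lemma act_minus [simp]: "act g (act (- g) x) = x" "act (- g) (act g x) = x"
  by (simp_all flip: act_add)

lemma continuous_act: "continuous_on A (act g)"
  using homeos continuous_on_subset[of UNIV "act g" A]
  by (auto simp: action_by_homeos_def homeomorphism_def)

lemma continuous_on_act_compose:
  assumes "continuous_on UNIV f"
  shows "continuous_on A (\<lambda>x. f (act g x))"
  by (rule continuous_on_compose2[OF assms continuous_act]) simp

lemma apply_Bcontfun:
  fixes f :: "'x \<Rightarrow> complex"
  assumes "continuous_on UNIV f"
  shows "apply_bcontfun (Bcontfun f) = f"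
proof (rule Bcontfun_inverse)
  have "bounded (range f)"
    using compact_continuous_image[OF assms compact_space] by (rule compact_imp_bounded)
  then show "f \<in> bcontfun"
    using assms by (simp add: bcontfun_def)
qed

lemma continuous_apply: "continuous_on A (apply_bcontfun (f :: 'x \<Rightarrow>\<^sub>C complex))"
  using apply_bcontfun[of f] continuous_on_subset[of UNIV "apply_bcontfun f" A]
  by (auto simp: bcontfun_def)

lemma Rep_monomial:
  "Rep_ell2 (blinfun_apply (monomial f g) x) (t, y) = apply_bcontfun f (act t y) * Rep_ell2 x (- g + t, y)"
  by (simp add: Rep_cfun_op Rep_unitary_op)

lemma sandwich_monomial:
  "cfun_op act f o\<^sub>L monomial k g o\<^sub>L cfun_op act h =
    monomial (Bcontfun (\<lambda>y. apply_bcontfun f y * apply_bcontfun k y * apply_bcontfun h (act (- g) y))) g"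
  (is "_ = monomial (Bcontfun ?p) g")
proof -
  have p: "apply_bcontfun (Bcontfun ?p) = ?p"
    by (intro apply_Bcontfun continuous_intros continuous_apply continuous_on_act_compose)
  show ?thesis
  proof (rule cop_eqI)
    fix x and i :: "'g \<times> 'x"
    obtain t y where i: "i = (t, y)" by (cases i)
    show "Rep_ell2 (blinfun_apply (cfun_op act f o\<^sub>L monomial k g o\<^sub>L cfun_op act h) x) i =
        Rep_ell2 (blinfun_apply (monomial (Bcontfun ?p) g) x) i"
      unfolding i Rep_monomial p by (simp add: Rep_cfun_op Rep_unitary_op act_add)
  qed
qed

lemma monomial_add: "monomial (f + h) g = monomial f g + monomial h g"
  by (rule cop_eqI) (auto simp: blinfun.add_left plus_ell2.rep_eq Rep_cfun_op Rep_unitary_op algebra_simps)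

lemma monomial_diff: "monomial (f - h) g = monomial f g - monomial h g"
  by (rule cop_eqI) (auto simp: blinfun.diff_left Rep_ell2_diff Rep_cfun_op Rep_unitary_op algebra_simps)

lemma monomial_zero: "monomial 0 g = 0"
  by (rule cop_eqI) (auto simp: zero_ell2.rep_eq Rep_cfun_op Rep_unitary_op)

lemma monomial_scale: "cop_scale c (monomial f g) = monomial (Bcontfun (\<lambda>y. c * apply_bcontfun f y)) g"
proof -
  have p: "apply_bcontfun (Bcontfun (\<lambda>y. c * apply_bcontfun f y)) = (\<lambda>y. c * apply_bcontfun f y)"
    by (intro apply_Bcontfun continuous_intros continuous_apply)
  show ?thesis
    by (rule cop_eqI) (auto simp: Rep_cop_scale Rep_cfun_op Rep_unitary_op p)
qed

lemma norm_monomial_le: "norm (monomial f g) \<le> norm f"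
proof -
  have "norm (monomial f g) \<le> norm (cfun_op act f) * norm (unitary_op g :: ('g \<times> 'x) ell2 \<Rightarrow>\<^sub>L ('g \<times> 'x) ell2)"
    by (rule norm_blinfun_compose)
  also have "\<dots> \<le> norm f * 1"
    by (intro mult_mono norm_cfun_op_le norm_unitary_op_le) auto
  finally show ?thesis by simp
qed

text \<open>
  The diagonal matrix entries along \<open>g\<close>: for \<open>T = \<Sum> f\<^sub>h u\<^sub>h\<close> the entry of \<open>T\<close> between the basis vectors
  at \<open>(0, x)\<close> and \<open>(g, x)\<close> is \<open>f\<^sub>g(g \<cdot> x)\<close>, so \<open>x = g\<inverse> \<cdot> y\<close> has to be taken to read off \<open>f\<^sub>g(y)\<close>.
\<close>

definition coeff :: "(('g \<times> 'x) ell2 \<Rightarrow>\<^sub>L ('g \<times> 'x) ell2) \<Rightarrow> 'g \<Rightarrow> 'x \<Rightarrow> complex" where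
  "coeff T g y = Rep_ell2 (blinfun_apply T (finite_vec {(0, act (- g) y)} (\<lambda>_. 1))) (g, act (- g) y)"

lemma coeff_add: "coeff (S + T) g y = coeff S g y + coeff T g y"
  and coeff_diff: "coeff (S - T) g y = coeff S g y - coeff T g y"
  and coeff_zero: "coeff 0 g y = 0"
  and coeff_scale: "coeff (cop_scale c T) g y = c * coeff T g y"
  and coeff_sum: "coeff (\<Sum>i\<in>I. R i) g y = (\<Sum>i\<in>I. coeff (R i) g y)"
  by (auto simp: coeff_def blinfun.add_left blinfun.diff_left plus_ell2.rep_eq Rep_ell2_diff
      zero_ell2.rep_eq Rep_cop_scale Rep_sum_op)

lemma norm_coeff_le: "cmod (coeff T g y) \<le> norm T"
proof -
  let ?d = "finite_vec {(0 :: 'g, act (- g) y)} (\<lambda>_. 1)"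
  have "(norm ?d)\<^sup>2 = 1" by (simp add: norm_finite_vec)
  then have d: "norm ?d = 1" by (simp add: power2_eq_1_iff) (use norm_ge_zero[of ?d] in linarith)
  have "cmod (coeff T g y) \<le> norm (blinfun_apply T ?d)"
    unfolding coeff_def by (rule cmod_Rep_le_norm)
  also have "\<dots> \<le> norm T * norm ?d" by (rule norm_blinfun)
  finally show ?thesis by (simp add: d)
qed

lemma coeff_monomial: "coeff (monomial f h) g y = (if g = h then apply_bcontfun f y else 0)"
proof -
  have "- h + g = 0 \<longleftrightarrow> g = h"
    by (metis add.right_inverse add_minus_cancel add.right_neutral neg_eq_iff_add_eq_0 minus_minus)
  then show ?thesis
    by (simp add: coeff_def Rep_cfun_op Rep_unitary_op Rep_finite_vec)
qed

lemma algebraic_finite_sum: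
  assumes "T \<in> algebraic_crossed_product"
  obtains S f where "finite S" "\<And>g. g \<notin> S \<Longrightarrow> f g = 0" "T = (\<Sum>g\<in>S. monomial (f g) g)"
proof -
  have "\<exists>S f. finite S \<and> (\<forall>g. g \<notin> S \<longrightarrow> f g = 0) \<and> T = (\<Sum>g\<in>S. monomial (f g) g)"
    using assms
  proof (induction rule: cop.span_induct_alt)
    case base
    show ?case by (intro exI[of _ "{}"] exI[of _ "\<lambda>_. 0"]) simp
  next
    case (step c x y)
    from step(1) obtain k h where x: "x = monomial k h" by blast
    from step(2) obtain S f where S: "finite S" "\<And>g. g \<notin> S \<Longrightarrow> f g = 0" "y = (\<Sum>g\<in>S. monomial (f g) g)"
      by blast
    let ?k = "Bcontfun (\<lambda>y. c * apply_bcontfun k y)"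
    let ?f = "\<lambda>g. (if g = h then ?k else 0) + f g"
    have "(\<Sum>g\<in>insert h S. monomial (?f g) g) =
        (\<Sum>g\<in>insert h S. monomial (if g = h then ?k else 0) g) + (\<Sum>g\<in>insert h S. monomial (f g) g)"
      unfolding monomial_add sum.distrib ..
    also have "(\<Sum>g\<in>insert h S. monomial (if g = h then ?k else 0) g) = (\<Sum>g\<in>insert h S. if g = h then monomial ?k h else 0)"
      by (intro sum.cong) (auto simp: monomial_zero)
    also have "\<dots> = cop_scale c x"
      using S(1) by (simp add: x monomial_scale)
    also have "(\<Sum>g\<in>insert h S. monomial (f g) g) = y"
      unfolding S(3) using S(1,2) by (intro sum.mono_neutral_right) (auto simp: monomial_zero)
    finally show ?case
      using S(1,2) by (intro exI[of _ "insert h S"] exI[of _ ?f]) auto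
  qed
  then show thesis using that by blast
qed

text \<open>
  Coefficients of finite sums of monomials are continuous, and \<open>coeff\<close> is contractive from the operator
  norm to the uniform norm, so uniform limits give the general case.
\<close>

lemma continuous_coeff:
  assumes "T \<in> reduced_crossed_product act"
  shows "continuous_on UNIV (coeff T g)"
proof -
  from assms obtain R where R: "\<And>n. R n \<in> algebraic_crossed_product" "R \<longlonglongrightarrow> T"
    unfolding reduced_crossed_product_def closure_sequential by blast
  have "continuous_on UNIV (coeff (R n) g)" for n
  proof -
    obtain S f where S: "R n = (\<Sum>g\<in>S. monomial (f g) g)"
      by (rule algebraic_finite_sum[OF R(1)])
    have "coeff (R n) g = (\<lambda>y. \<Sum>h\<in>S. if g = h then apply_bcontfun (f h) y else 0)"
      unfolding S by (simp add: fun_eq_iff coeff_sum coeff_monomial)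
    moreover have "continuous_on UNIV (\<lambda>y. if g = h then apply_bcontfun (f h) y else 0)" for h
      by (cases "g = h") (simp_all add: continuous_apply)
    then have "continuous_on UNIV (\<lambda>y. \<Sum>h\<in>S. if g = h then apply_bcontfun (f h) y else 0)"
      by (rule continuous_on_sum)
    ultimately show ?thesis by simp
  qed
  moreover have "uniform_limit UNIV (\<lambda>n. coeff (R n) g) (coeff T g) sequentially"
  proof (rule uniform_limitI)
    fix e :: real assume "0 < e"
    with R(2) have "\<forall>\<^sub>F n in sequentially. dist (R n) T < e" by (rule tendstoD)
    then show "\<forall>\<^sub>F n in sequentially. \<forall>y\<in>UNIV. dist (coeff (R n) g y) (coeff T g y) < e"
    proof eventually_elim
      case (elim n)
      then show ?case
        using norm_coeff_le[of "R n - T" g] by (auto simp: dist_norm coeff_diff intro: le_less_trans)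
    qed
  qed
  ultimately show ?thesis
    by (intro uniform_limit_theorem[where f = "\<lambda>n. coeff (R n) g" and F = sequentially]) auto
qed

definition fourier :: "(('g \<times> 'x) ell2 \<Rightarrow>\<^sub>L ('g \<times> 'x) ell2) \<Rightarrow> 'g \<Rightarrow> 'x \<Rightarrow>\<^sub>C complex" where
  "fourier T g = Bcontfun (coeff T g)"

lemma apply_fourier:
  "T \<in> reduced_crossed_product act \<Longrightarrow> apply_bcontfun (fourier T g) = coeff T g"
  unfolding fourier_def by (intro apply_Bcontfun continuous_coeff)

lemma algebraic_subset: "algebraic_crossed_product \<subseteq> reduced_crossed_product act"
  unfolding reduced_crossed_product_def by (rule closure_subset)

lemma norm_fourier_diff_le:
  assumes "S \<in> reduced_crossed_product act" "T \<in> reduced_crossed_product act"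
  shows "norm (fourier S g - fourier T g) \<le> norm (S - T)"
  using norm_coeff_le[of "S - T" g]
  by (intro norm_bound) (simp add: apply_fourier assms coeff_diff)

text \<open>
  The functions in a representation as a finite sum of monomials are recovered as the Fourier
  coefficients, so the representation is unique up to zero terms.
\<close>

lemma algebraic_fourier_sum:
  assumes "T \<in> algebraic_crossed_product"
  obtains S where "finite S" "\<And>g. g \<notin> S \<Longrightarrow> fourier T g = 0" "T = (\<Sum>g\<in>S. monomial (fourier T g) g)"
proof -
  obtain S f where S: "finite S" "\<And>g. g \<notin> S \<Longrightarrow> f g = 0" "T = (\<Sum>g\<in>S. monomial (f g) g)"
    using algebraic_finite_sum[OF assms] by blast
  have "fourier T g = f g" for g
  proof (rule bcontfun_eqI)
    fix y
    have "apply_bcontfun (fourier T g) y = coeff T g y"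
      using assms algebraic_subset by (simp add: apply_fourier subset_iff)
    also have "\<dots> = (\<Sum>h\<in>S. if g = h then apply_bcontfun (f h) y else 0)"
      unfolding S(3) by (simp add: coeff_sum coeff_monomial)
    also have "\<dots> = apply_bcontfun (f g) y"
      using S(1,2) by simp
    finally show "apply_bcontfun (fourier T g) y = apply_bcontfun (f g) y" .
  qed
  with S show thesis by (intro that) auto
qed

section \<open>Multipliers and Fourier synthesis\<close>

lemma sum_over_translates:
  fixes h :: "'g \<Rightarrow> 'g \<Rightarrow> complex"
  assumes "finite E" "finite S"
  shows "(\<Sum>t\<in>E. if s - t \<in> S then h (s - t) t else 0) = (\<Sum>g\<in>S. if - g + s \<in> E then h g (- g + s) else 0)"
proof -
  have 1: "s - (- g + s) = g" for g
    by (simp add: diff_conv_add_uminus minus_add del: add_uminus_conv_diff)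
  have "(\<Sum>t\<in>{t\<in>E. s - t \<in> S}. h (s - t) t) = (\<Sum>g\<in>{g\<in>S. - g + s \<in> E}. h g (- g + s))"
    by (rule sum.reindex_bij_witness[of _ "\<lambda>g. - g + s" "\<lambda>t. s - t"]) (auto simp: 1)
  then show ?thesis
    using assms by (simp add: sum.inter_filter)
qed

text \<open>
  On the fibre over \<open>y\<close>, a finite sum \<open>T = \<Sum> f\<^sub>g u\<^sub>g\<close> acts on \<open>\<ell>\<^sup>2(\<Gamma>)\<close> as the matrix with entries
  \<open>f\<^sub>g(s \<cdot> y)\<close> at \<open>(s, t)\<close>, where \<open>g = s t\<inverse>\<close>, and the multiplier acts on it as the
  Schur multiplier with symbol \<open>u(s t\<inverse>)\<close>.  Every finite compression of the matrix has norm at most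
  \<open>\<parallel>T\<parallel>\<close>, so the Schur bound applies fibre by fibre.
\<close>

lemma norm_multiplier_le:
  assumes u: "cb_multiplier_bound u C" and S: "finite S"
  shows "norm (\<Sum>g\<in>S. cop_scale (u g) (monomial (f g) g)) \<le> C * norm (\<Sum>g\<in>S. monomial (f g) g)"
    (is "norm ?U \<le> C * norm ?T")
proof (rule norm_blinfun_bound)
  have C: "0 \<le> C" using u by (simp add: cb_multiplier_bound_def)
  then show "0 \<le> C * norm ?T" by simp
  fix x
  show "norm (blinfun_apply ?U x) \<le> C * norm ?T * norm x"
  proof (rule norm_ell2_leI)
    show "0 \<le> C * norm ?T * norm x" using C by simp
    fix F :: "('g \<times> 'x) set" assume F: "finite F"
    \<comment> \<open>\<open>E\<close> contains the rows met by \<open>F\<close> together with all columns in which these rows of the matrix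
      are nonzero, so that compressing to \<open>E\<close> does not change the rows in question.\<close>
    define E where "E = fst ` F \<union> (\<lambda>(t, g). - g + t) ` (fst ` F \<times> S)"
    define k where "k y s t = (if s - t \<in> S then apply_bcontfun (f (s - t)) (act s y) else 0)" for y s t
    have E: "finite E" using F S by (simp add: E_def)
    have bd: "(\<Sum>s\<in>E. (cmod (\<Sum>t\<in>E. k y s t * z t))\<^sup>2) \<le> (norm ?T)\<^sup>2 * (\<Sum>t\<in>E. (cmod (z t))\<^sup>2)" for y z
    proof -
      define v where "v = finite_vec (E \<times> {y}) (\<lambda>(t, _). z t)"
      have Ey: "finite (E \<times> {y})" using E by simp
      have sum_Ey: "(\<Sum>p\<in>E \<times> {y}. h p) = (\<Sum>s\<in>E. h (s, y))" for h :: "'g \<times> 'x \<Rightarrow> real"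
        by (rule sum.reindex_bij_witness[of _ "\<lambda>s. (s, y)" fst]) auto
      have row: "(\<Sum>t\<in>E. k y s t * z t) = Rep_ell2 (blinfun_apply ?T v) (s, y)" for s
      proof -
        have "(\<Sum>t\<in>E. k y s t * z t) =
            (\<Sum>t\<in>E. if s - t \<in> S then apply_bcontfun (f (s - t)) (act s y) * z t else 0)"
          by (intro sum.cong) (auto simp: k_def)
        also have "\<dots> = (\<Sum>g\<in>S. if - g + s \<in> E then apply_bcontfun (f g) (act s y) * z (- g + s) else 0)"
          using E S by (rule sum_over_translates)
        also have "\<dots> = Rep_ell2 (blinfun_apply ?T v) (s, y)"
          unfolding Rep_sum_op Rep_monomial by (intro sum.cong) (auto simp: v_def Rep_finite_vec[OF Ey])
        finally show ?thesis .
      qed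
      have nv: "(norm v)\<^sup>2 = (\<Sum>t\<in>E. (cmod (z t))\<^sup>2)"
        unfolding v_def norm_finite_vec[OF Ey] sum_Ey by simp
      have "(\<Sum>s\<in>E. (cmod (\<Sum>t\<in>E. k y s t * z t))\<^sup>2) = (\<Sum>p\<in>E \<times> {y}. (cmod (Rep_ell2 (blinfun_apply ?T v) p))\<^sup>2)"
        unfolding row sum_Ey ..
      also have "\<dots> \<le> (norm (blinfun_apply ?T v))\<^sup>2"
        using Ey by (rule sum_le_norm_ell2)
      also have "\<dots> \<le> (norm ?T * norm v)\<^sup>2"
        by (intro power_mono norm_blinfun) simp
      finally show ?thesis by (simp add: power_mult_distrib nv)
    qed
    have row: "Rep_ell2 (blinfun_apply ?U x) (s, y) = (\<Sum>t\<in>E. u (s - t) * k y s t * Rep_ell2 x (t, y))"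
      if "s \<in> fst ` F" for s y
    proof -
      have in_E: "- g + s \<in> E" if "g \<in> S" for g
        using \<open>s \<in> fst ` F\<close> that by (force simp: E_def)
      have "Rep_ell2 (blinfun_apply ?U x) (s, y) =
          (\<Sum>g\<in>S. if - g + s \<in> E then u g * apply_bcontfun (f g) (act s y) * Rep_ell2 x (- g + s, y) else 0)"
        unfolding Rep_sum_op Rep_cop_scale Rep_monomial by (intro sum.cong) (auto simp: in_E)
      also have "\<dots> = (\<Sum>t\<in>E. if s - t \<in> S then
          u (s - t) * apply_bcontfun (f (s - t)) (act s y) * Rep_ell2 x (t, y) else 0)"
        by (rule sum_over_translates[OF E S, symmetric])
      also have "\<dots> = (\<Sum>t\<in>E. u (s - t) * k y s t * Rep_ell2 x (t, y))"
        by (intro sum.cong) (auto simp: k_def)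
      finally show ?thesis .
    qed
    define Y where "Y = snd ` F"
    have Y: "finite Y" using F by (simp add: Y_def)
    have "(\<Sum>p\<in>F. (cmod (Rep_ell2 (blinfun_apply ?U x) p))\<^sup>2)
        = (\<Sum>(s, y)\<in>F. (cmod (\<Sum>t\<in>E. u (s - t) * k y s t * Rep_ell2 x (t, y)))\<^sup>2)"
    proof (intro sum.cong refl)
      fix p assume "p \<in> F"
      then show "(cmod (Rep_ell2 (blinfun_apply ?U x) p))\<^sup>2 =
          (case p of (s, y) \<Rightarrow> (cmod (\<Sum>t\<in>E. u (s - t) * k y s t * Rep_ell2 x (t, y)))\<^sup>2)"
        using row[of "fst p" "snd p"] by (auto simp: case_prod_beta)
    qed
    also have "\<dots> \<le> (\<Sum>(s, y)\<in>E \<times> Y. (cmod (\<Sum>t\<in>E. u (s - t) * k y s t * Rep_ell2 x (t, y)))\<^sup>2)"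
      using E Y by (intro sum_mono2) (force simp: E_def Y_def)+
    also have "\<dots> = (\<Sum>y\<in>Y. \<Sum>s\<in>E. (cmod (\<Sum>t\<in>E. u (s - t) * k y s t * Rep_ell2 x (t, y)))\<^sup>2)"
      by (subst sum.swap) (simp add: sum.cartesian_product)
    also have "\<dots> \<le> (\<Sum>y\<in>Y. (C * norm ?T)\<^sup>2 * (\<Sum>t\<in>E. (cmod (Rep_ell2 x (t, y)))\<^sup>2))"
      by (intro sum_mono cb_multiplier_schur_bound[OF u E _ bd]) simp
    also have "\<dots> = (C * norm ?T)\<^sup>2 * (\<Sum>y\<in>Y. \<Sum>t\<in>E. (cmod (Rep_ell2 x (t, y)))\<^sup>2)"
      by (rule sum_distrib_left[symmetric])
    also have "\<dots> = (C * norm ?T)\<^sup>2 * (\<Sum>p\<in>E \<times> Y. (cmod (Rep_ell2 x p))\<^sup>2)"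
      by (subst sum.swap) (simp add: sum.cartesian_product case_prod_beta)
    also have "\<dots> \<le> (C * norm ?T)\<^sup>2 * (norm x)\<^sup>2"
      using E Y by (intro mult_left_mono sum_le_norm_ell2) auto
    finally show "(\<Sum>p\<in>F. (cmod (Rep_ell2 (blinfun_apply ?U x) p))\<^sup>2) \<le> (C * norm ?T * norm x)\<^sup>2"
      by (simp add: power_mult_distrib)
  qed
qed

lemma monomial_fourier_tendsto:
  assumes "\<And>n. R n \<in> reduced_crossed_product act" "T \<in> reduced_crossed_product act" "R \<longlonglongrightarrow> T"
  shows "(\<lambda>n. monomial (fourier (R n) g) g) \<longlonglongrightarrow> monomial (fourier T g) g"
proof (rule metric_tendsto_imp_tendsto[OF assms(3)], rule always_eventually, rule allI)
  fix n
  have "dist (monomial (fourier (R n) g) g) (monomial (fourier T g) g) = norm (monomial (fourier (R n) g - fourier T g) g)"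
    by (simp only: dist_norm monomial_diff)
  also have "\<dots> \<le> norm (R n - T)"
    using norm_monomial_le norm_fourier_diff_le[OF assms(1,2)] by (rule order_trans)
  finally show "dist (monomial (fourier (R n) g) g) (monomial (fourier T g) g) \<le> dist (R n) T"
    by (simp add: dist_norm)
qed

text \<open>
  If \<open>T \<notin> V\<close>, a functional \<open>\<psi>\<close> separates \<open>T\<close> from \<open>V\<close>, and \<open>\<omega>(u) = \<psi>(M\<^sub>u T)\<close> contradicts the
  approximation property.  Here \<open>\<psi>(M\<^sub>u T)\<close> is only notation for \<open>lim \<psi>(M\<^sub>u R\<^sub>n)\<close> with finite sums \<open>R\<^sub>n\<close>
  tending to \<open>T\<close>: the scalars are extended instead of the operators \<open>M\<^sub>u R\<^sub>n\<close>, so that completeness of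
  the complex numbers suffices.  For finitely supported \<open>u\<close> the limit can be taken term by term.
\<close>

lemma fourier_synthesis:
  assumes AP: "approximation_property TYPE('g)"
    and T: "T \<in> reduced_crossed_product act"
    and V: "cop.subspace V" "closed V"
    and coeffs: "\<And>g. monomial (fourier T g) g \<in> V"
  shows "T \<in> V"
proof (rule ccontr)
  assume "T \<notin> V"
  then obtain \<rho> where \<rho>: "bounded_linear \<rho>" "\<And>S. S \<in> V \<Longrightarrow> \<rho> S = 0" "\<rho> T \<noteq> (0 :: real)"
    using closed_subspace_separation[OF cop_subspace_imp_subspace[OF V(1)] V(2)] by blast
  interpret \<rho>: bounded_linear \<rho> by fact
  \<comment> \<open>The complex linear functional with real part \<open>\<rho>\<close>.\<close>
  define \<psi> where "\<psi> S = Complex (\<rho> S) (- \<rho> (cop_scale \<i> S))" for S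
  have \<psi>_add: "\<psi> (R + S) = \<psi> R + \<psi> S" for R S
    by (simp add: \<psi>_def complex_eq_iff \<rho>.add cop.scale_right_distrib)
  have \<psi>_scale: "\<psi> (cop_scale c S) = c * \<psi> S" for c S
  proof -
    have c: "cop_scale c S = Re c *\<^sub>R S + Im c *\<^sub>R cop_scale \<i> S" for c S
    proof -
      have "cop_scale c S = cop_scale (of_real (Re c) + of_real (Im c) * \<i>) S"
        by (simp add: complex_eq mult.commute)
      also have "\<dots> = Re c *\<^sub>R S + Im c *\<^sub>R cop_scale \<i> S"
        by (simp only: cop.scale_left_distrib cop.scale_scale[symmetric] cop_scale_of_real)
      finally show ?thesis .
    qed
    have "cop_scale \<i> (cop_scale c S) = cop_scale (\<i> * c) S"
      by simp
    then have "\<psi> (cop_scale c S) = Complex (\<rho> (cop_scale c S)) (- \<rho> (cop_scale (\<i> * c) S))"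
      by (simp add: \<psi>_def)
    then show ?thesis
      unfolding c[of c] c[of "\<i> * c"] by (simp add: \<psi>_def complex_eq_iff \<rho>.add \<rho>.diff \<rho>.scaleR)
  qed
  have \<psi>_sum: "\<psi> (\<Sum>i\<in>I. R i) = (\<Sum>i\<in>I. \<psi> (R i))" for I :: "'g set" and R
    by (induction I rule: infinite_finite_induct)
      (simp_all add: \<psi>_add, simp_all add: \<psi>_def \<rho>.zero complex_eq_iff)
  have \<psi>_diff: "\<psi> (R - S) = \<psi> R - \<psi> S" for R S
    using \<psi>_add[of "R - S" S] by simp
  obtain K0 where K0: "\<And>S. norm (\<rho> S) \<le> norm S * K0" "0 < K0"
    using \<rho>.pos_bounded by blast
  define K where "K = 2 * K0"
  have K: "0 < K" "cmod (\<psi> S) \<le> K * norm S" for S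
  proof -
    have "cmod (\<psi> S) \<le> \<bar>\<rho> S\<bar> + \<bar>\<rho> (cop_scale \<i> S)\<bar>"
      using cmod_le[of "\<psi> S"] by (simp add: \<psi>_def)
    also have "\<dots> \<le> norm S * K0 + norm (cop_scale \<i> S) * K0"
      using K0(1)[of S] K0(1)[of "cop_scale \<i> S"] by simp
    also have "\<dots> \<le> norm S * K0 + norm S * K0"
      using norm_cop_scale_le[of \<i> S] K0(2) by (intro add_left_mono mult_right_mono) auto
    finally show "cmod (\<psi> S) \<le> K * norm S" by (simp add: K_def algebra_simps)
  qed (simp add: K_def K0)
  have \<psi>_tendsto: "(\<lambda>n. \<psi> (R n)) \<longlonglongrightarrow> \<psi> S" if "R \<longlonglongrightarrow> S" for R S
  proof (rule LIM_zero_cancel, rule Lim_null_comparison)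
    show "\<forall>\<^sub>F n in sequentially. norm (\<psi> (R n) - \<psi> S) \<le> K * norm (R n - S)"
      unfolding \<psi>_diff[symmetric] using K(2) by (intro always_eventually allI)
    have "(\<lambda>n. K * norm (R n - S)) \<longlonglongrightarrow> K * 0"
      using that by (intro tendsto_mult tendsto_const tendsto_norm_zero LIM_zero)
    then show "(\<lambda>n. K * norm (R n - S)) \<longlonglongrightarrow> 0" by simp
  qed
  have \<psi>_V: "\<psi> S = 0" if "S \<in> V" for S
    using \<rho>(2)[OF that] \<rho>(2)[OF cop.subspace_scale[OF V(1) that]] by (simp add: \<psi>_def complex_eq_iff)
  have \<psi>_T: "\<psi> T \<noteq> 0"
    using \<rho>(3) by (simp add: \<psi>_def complex_eq_iff)

  from T obtain R where R: "\<And>n. R n \<in> algebraic_crossed_product" and lim: "R \<longlonglongrightarrow> T"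
    unfolding reduced_crossed_product_def closure_sequential by blast
  have RA: "R n \<in> reduced_crossed_product act" for n
    using R algebraic_subset by blast
  have "\<exists>S. finite S \<and> (\<forall>g. g \<notin> S \<longrightarrow> fourier (R n) g = 0) \<and> R n = (\<Sum>g\<in>S. monomial (fourier (R n) g) g)" for n
    by (rule algebraic_fourier_sum[OF R[of n]]) blast
  then have "\<exists>S. \<forall>n. finite (S n) \<and> (\<forall>g. g \<notin> S n \<longrightarrow> fourier (R n) g = 0) \<and>
      R n = (\<Sum>g\<in>S n. monomial (fourier (R n) g) g)"
    by (intro choice allI)
  then obtain S where "\<forall>n. finite (S n) \<and> (\<forall>g. g \<notin> S n \<longrightarrow> fourier (R n) g = 0) \<and>
      R n = (\<Sum>g\<in>S n. monomial (fourier (R n) g) g)" ..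
  then have S: "\<And>n. finite (S n)" "\<And>n g. g \<notin> S n \<Longrightarrow> fourier (R n) g = 0"
      "\<And>n. R n = (\<Sum>g\<in>S n. monomial (fourier (R n) g) g)"
    by blast+
  define c where "c n g = \<psi> (monomial (fourier (R n) g) g)" for n g
  have c0: "c n g = 0" if "g \<notin> S n" for n g
    using S(2)[OF that] \<psi>_V[OF cop.subspace_0[OF V(1)]] by (simp add: c_def monomial_zero)
  \<comment> \<open>\<open>N n u = \<psi> (M\<^sub>u (R n))\<close>\<close>
  define N where "N n u = (\<Sum>g\<in>S n. u g * c n g)" for n and u :: "'g \<Rightarrow> complex"
  have N_alt: "N n u = (\<Sum>g\<in>I. u g * c n g)" if "finite I" "S n \<subseteq> I" for n u I
    unfolding N_def using that by (intro sum.mono_neutral_left) (auto simp: c0)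
  have R_alt: "R n = (\<Sum>g\<in>I. monomial (fourier (R n) g) g)" if "finite I" "S n \<subseteq> I" for n I
    by (subst S(3)) (use that in \<open>intro sum.mono_neutral_left, auto simp: S(2) monomial_zero\<close>)
  have N_diff: "cmod (N n u - N m u) \<le> K * (cb_norm u * norm (R n - R m))" if u: "u \<in> cb_multipliers" for n m u
  proof -
    let ?I = "S n \<union> S m"
    let ?f = "\<lambda>g. fourier (R n) g - fourier (R m) g"
    have I: "finite ?I" using S(1) by simp
    have "N n u - N m u = (\<Sum>g\<in>?I. u g * c n g) - (\<Sum>g\<in>?I. u g * c m g)"
      using N_alt[of ?I n u] N_alt[of ?I m u] I by simp
    also have "\<dots> = (\<Sum>g\<in>?I. \<psi> (cop_scale (u g) (monomial (?f g) g)))"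
      unfolding sum_subtractf[symmetric] c_def \<psi>_scale monomial_diff \<psi>_diff right_diff_distrib ..
    also have "\<dots> = \<psi> (\<Sum>g\<in>?I. cop_scale (u g) (monomial (?f g) g))"
      by (rule \<psi>_sum[symmetric])
    also have "cmod \<dots> \<le> K * norm (\<Sum>g\<in>?I. cop_scale (u g) (monomial (?f g) g))"
      by (rule K(2))
    also have "\<dots> \<le> K * (cb_norm u * norm (\<Sum>g\<in>?I. monomial (?f g) g))"
      using K(1) by (intro mult_left_mono norm_multiplier_le cb_multiplier_bound_cb_norm u I) simp
    also have "(\<Sum>g\<in>?I. monomial (?f g) g) = R n - R m"
      unfolding monomial_diff sum_subtractf using R_alt[of ?I n] R_alt[of ?I m] I by simp
    finally show ?thesis .
  qed
  define \<omega> where "\<omega> u = lim (\<lambda>n. N n u)" for u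
  have N_lim: "(\<lambda>n. N n u) \<longlonglongrightarrow> \<omega> u" if u: "u \<in> cb_multipliers" for u
  proof -
    have "Cauchy (\<lambda>n. N n u)"
    proof (rule metric_CauchyI)
      fix e :: real assume e: "0 < e"
      have b: "0 \<le> K * cb_norm u" using K(1) cb_norm_nonneg[OF u] by simp
      have "Cauchy R" using lim by (rule LIMSEQ_imp_Cauchy)
      then obtain M where M: "\<forall>m\<ge>M. \<forall>n\<ge>M. dist (R m) (R n) < e / (K * cb_norm u + 1)"
        using e b by (meson metric_CauchyD divide_pos_pos add_nonneg_pos zero_less_one)
      have "dist (N m u) (N n u) < e" if "M \<le> m" "M \<le> n" for m n
      proof -
        have "dist (N m u) (N n u) \<le> (K * cb_norm u) * dist (R m) (R n)"
          using N_diff[OF u, of m n] by (simp add: dist_norm mult.assoc)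
        also have "\<dots> \<le> (K * cb_norm u + 1) * dist (R m) (R n)"
          by (intro mult_right_mono) auto
        also have "\<dots> < e"
          using M that b by (auto simp: field_simps)
        finally show ?thesis .
      qed
      then show "\<exists>M. \<forall>m\<ge>M. \<forall>n\<ge>M. dist (N m u) (N n u) < e" by blast
    qed
    then show ?thesis
      unfolding \<omega>_def using Cauchy_convergent_iff convergent_LIMSEQ_iff by blast
  qed
  \<comment> \<open>The \<open>\<ell>\<^sup>1\<close> functional within \<open>e\<close> of \<open>\<omega>\<close> is \<open>N n\<close> for an \<open>R n\<close> close to \<open>T\<close>.\<close>
  have \<omega>_predual: "\<omega> \<in> cb_predual"
    unfolding cb_predual_def
  proof (intro CollectI allI impI)
    fix e :: real assume e: "0 < e"
    have "(\<lambda>n. K * norm (R n - T)) \<longlonglongrightarrow> K * 0"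
      using lim by (intro tendsto_mult tendsto_const tendsto_norm_zero LIM_zero)
    then have "\<forall>\<^sub>F n in sequentially. K * norm (R n - T) < e"
      using e by (intro order_tendstoD(2)[of _ "K * 0"]) auto
    then obtain n where n: "K * norm (R n - T) < e"
      unfolding eventually_sequentially by blast
    have summ: "(\<lambda>g. cmod (c n g)) summable_on UNIV"
      using S(1)[of n] by (intro summable_on_cong_neutral[THEN iffD1, OF _ _ _ summable_on_finite[of "S n"]])
        (auto simp: c0)
    have infs: "(\<Sum>\<^sub>\<infinity>g. c n g * u g) = N n u" for u
    proof -
      have "(\<Sum>\<^sub>\<infinity>g. c n g * u g) = (\<Sum>\<^sub>\<infinity>g\<in>S n. c n g * u g)"
        by (rule infsum_cong_neutral) (auto simp: c0)
      then show ?thesis using S(1)[of n] by (simp add: N_def mult.commute)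
    qed
    have "cmod (\<omega> u - (\<Sum>\<^sub>\<infinity>g. c n g * u g)) \<le> e * cb_norm u" if u: "u \<in> cb_multipliers" for u
    proof -
      have "(\<lambda>m. cmod (N m u - N n u)) \<longlonglongrightarrow> cmod (\<omega> u - N n u)"
        by (intro tendsto_norm tendsto_diff N_lim[OF u] tendsto_const)
      moreover have "(\<lambda>m. K * (cb_norm u * norm (R m - R n))) \<longlonglongrightarrow> K * (cb_norm u * norm (T - R n))"
        by (intro tendsto_mult tendsto_norm tendsto_diff lim tendsto_const)
      ultimately have "cmod (\<omega> u - N n u) \<le> K * (cb_norm u * norm (T - R n))"
        using N_diff[OF u] by (intro LIMSEQ_le) auto
      also have "\<dots> = (K * norm (R n - T)) * cb_norm u"
        by (simp add: norm_minus_commute)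
      also have "\<dots> \<le> e * cb_norm u"
        using n by (intro mult_right_mono cb_norm_nonneg u) auto
      finally show ?thesis unfolding infs .
    qed
    with summ show "\<exists>\<phi>. (\<lambda>g. cmod (\<phi> g)) summable_on UNIV \<and>
        (\<forall>u\<in>cb_multipliers. cmod (\<omega> u - (\<Sum>\<^sub>\<infinity>g. \<phi> g * u g)) \<le> e * cb_norm u)"
      by blast
  qed
  have \<omega>_one: "\<omega> (\<lambda>_. 1) = \<psi> T"
  proof -
    have "N n (\<lambda>_. 1) = \<psi> (R n)" for n
      by (subst S(3)) (simp add: N_def c_def \<psi>_sum)
    then show ?thesis
      unfolding \<omega>_def using \<psi>_tendsto[OF lim] by (simp add: limI)
  qed
  have \<omega>_finite: "\<omega> u = 0" if u: "finite {g. u g \<noteq> 0}" for u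
  proof -
    have "N n u = (\<Sum>g | u g \<noteq> 0. u g * c n g)" for n
      unfolding N_def using u S(1)[of n] by (intro sum.mono_neutral_cong) (auto simp: c0)
    moreover have "(\<lambda>n. \<Sum>g | u g \<noteq> 0. u g * c n g) \<longlonglongrightarrow> (\<Sum>g | u g \<noteq> 0. u g * \<psi> (monomial (fourier T g) g))"
      unfolding c_def
      by (intro tendsto_sum tendsto_mult tendsto_const \<psi>_tendsto monomial_fourier_tendsto RA T lim)
    ultimately have "(\<lambda>n. N n u) \<longlonglongrightarrow> 0"
      by (simp add: \<psi>_V[OF coeffs])
    then show ?thesis unfolding \<omega>_def by (rule limI)
  qed
  from AP obtain F :: "('g \<Rightarrow> complex) filter" where F: "F \<noteq> bot"
      "\<forall>\<^sub>F f in F. finite {g. f g \<noteq> 0}" "(\<omega> \<longlongrightarrow> \<omega> (\<lambda>_. 1)) F"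
    unfolding approximation_property_def using \<omega>_predual by blast
  have "\<forall>\<^sub>F f in F. \<omega> f = 0"
    using F(2) by eventually_elim (rule \<omega>_finite)
  then have "(\<omega> \<longlongrightarrow> 0) F" by (rule tendsto_eventually)
  with F(1,3) have "\<omega> (\<lambda>_. 1) = 0" by (intro tendsto_unique)
  with \<omega>_one \<psi>_T show False by simp
qed

end

section \<open>Free actions and closed bimodules\<close>

lemma compact_t2_urysohn_point:
  fixes V :: "'x::t2_space set"
  assumes "compact (UNIV :: 'x set)" "open V" "x \<in> V"
  obtains q :: "'x \<Rightarrow> real" where "continuous_on UNIV q" "q x = 1" "\<And>y. y \<notin> V \<Longrightarrow> q y = 0"
proof -
  let ?X = "euclidean :: 'x topology"
  have "Hausdorff_space ?X"
    using hausdorff[where 'a = 'x] by (fastforce simp: Hausdorff_space_def disjnt_def)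
  moreover have "compact_space ?X"
    using assms(1) by (simp add: compact_space_def)
  ultimately have "normal_space ?X"
    by (intro compact_Hausdorff_or_regular_imp_normal_space) auto
  moreover have "closedin ?X (- V)" "closedin ?X {x}" "disjnt (- V) {x}"
    using assms(2,3) by (auto simp: disjnt_def closed_Compl)
  ultimately obtain q where q: "continuous_map ?X (top_of_set {0..1 :: real}) q"
      "q ` (- V) \<subseteq> {0}" "q ` {x} \<subseteq> {1}"
    using Urysohn_lemma[of ?X "- V" "{x}" 0 1] by auto
  show thesis
  proof
    show "continuous_on UNIV q"
      using q(1) continuous_map_into_fulltopology[of ?X euclidean "{0..1}" q]
      by (simp add: continuous_map_iff_continuous2)
  qed (use q in auto)
qed

text \<open>
  Multiplication by a real function is self-adjoint.
\<close>

lemma inner_cfun_op: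
  assumes "\<And>y. apply_bcontfun a y = of_real (r y)"
  shows "inner (blinfun_apply (cfun_op act a) x) y = inner x (blinfun_apply (cfun_op act a) y)"
proof -
  have "(of_real s * z) \<bullet> w = z \<bullet> (of_real s * w)" for s and z w :: complex
    by (simp add: inner_complex_def)
  then show ?thesis
    unfolding inner_ell2.rep_eq by (intro infsum_cong) (auto simp: Rep_cfun_op assms)
qed

text \<open>
  With \<open>A\<^sub>i\<close> and \<open>B\<^sub>i\<close> the multiplication operators, \<open>\<Sum> \<parallel>A\<^sub>i y\<parallel>\<^sup>2 = \<parallel>y\<parallel>\<^sup>2\<close> and likewise for \<open>B\<^sub>i\<close>.  Hence
  \<open>\<langle>\<Sum> A\<^sub>i T B\<^sub>i x, y\<rangle> = \<Sum> \<langle>T B\<^sub>i x, A\<^sub>i y\<rangle> \<le> \<parallel>T\<parallel> \<parallel>x\<parallel> \<parallel>y\<parallel>\<close> by the Cauchy-Schwarz inequality.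
\<close>

lemma averaging_contraction:
  fixes act :: "'g \<Rightarrow> 'x::topological_space \<Rightarrow> 'x" and a b :: "'i \<Rightarrow> 'x \<Rightarrow>\<^sub>C complex"
  assumes a: "\<And>i y. apply_bcontfun (a i) y = of_real (p i y)" "\<And>y. (\<Sum>i\<in>I. (p i y)\<^sup>2) = 1"
    and b: "\<And>i y. apply_bcontfun (b i) y = of_real (q i y)" "\<And>y. (\<Sum>i\<in>I. (q i y)\<^sup>2) = 1"
  shows "norm (\<Sum>i\<in>I. cfun_op act (a i) o\<^sub>L T o\<^sub>L cfun_op act (b i)) \<le> norm T"
proof (rule norm_blinfun_bound)
  fix x
  let ?S = "\<Sum>i\<in>I. cfun_op act (a i) o\<^sub>L T o\<^sub>L cfun_op act (b i)"
  have part: "(\<Sum>i\<in>I. (norm (blinfun_apply (cfun_op act (c i)) x))\<^sup>2) = (norm x)\<^sup>2"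
    if c: "\<And>i y. apply_bcontfun (c i) y = of_real (r i y)" "\<And>y. (\<Sum>i\<in>I. (r i y)\<^sup>2) = 1"
    for c :: "'i \<Rightarrow> 'x \<Rightarrow>\<^sub>C complex" and r and x :: "('g \<times> 'x) ell2"
  proof -
    have "(\<Sum>i\<in>I. (norm (blinfun_apply (cfun_op act (c i)) x))\<^sup>2) =
        inner x (\<Sum>i\<in>I. blinfun_apply (cfun_op act (c i)) (blinfun_apply (cfun_op act (c i)) x))"
      by (simp add: power2_norm_eq_inner inner_cfun_op[OF c(1)] inner_sum_right)
    also have "(\<Sum>i\<in>I. blinfun_apply (cfun_op act (c i)) (blinfun_apply (cfun_op act (c i)) x)) = x"
    proof (rule ell2_eqI)
      fix j :: "'g \<times> 'x"
      obtain t y where j: "j = (t, y)" by (cases j)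
      have "Rep_ell2 (\<Sum>i\<in>I. blinfun_apply (cfun_op act (c i)) (blinfun_apply (cfun_op act (c i)) x)) j =
          of_real (\<Sum>i\<in>I. (r i (act t y))\<^sup>2) * Rep_ell2 x j"
        by (simp add: j Rep_ell2_sum Rep_cfun_op c(1) sum_distrib_right power2_eq_square mult.assoc)
      then show "Rep_ell2 (\<Sum>i\<in>I. blinfun_apply (cfun_op act (c i)) (blinfun_apply (cfun_op act (c i)) x)) j =
          Rep_ell2 x j"
        by (simp only: c(2)) simp
    qed
    finally show ?thesis by (simp add: power2_norm_eq_inner)
  qed
  define y where "y = blinfun_apply ?S x"
  let ?A = "\<lambda>i. norm (blinfun_apply (cfun_op act (a i)) y)"
  let ?B = "\<lambda>i. norm (blinfun_apply (cfun_op act (b i)) x)"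
  have "(norm y)\<^sup>2 = inner (blinfun_apply ?S x) y"
    by (simp add: y_def power2_norm_eq_inner)
  also have "\<dots> = (\<Sum>i\<in>I. inner (blinfun_apply T (blinfun_apply (cfun_op act (b i)) x))
      (blinfun_apply (cfun_op act (a i)) y))"
    by (simp add: blinfun.sum_left inner_sum_left inner_cfun_op[OF a(1)])
  also have "\<dots> \<le> (\<Sum>i\<in>I. norm T * (\<bar>?B i\<bar> * \<bar>?A i\<bar>))"
  proof (rule sum_mono)
    fix i
    have "inner (blinfun_apply T (blinfun_apply (cfun_op act (b i)) x)) (blinfun_apply (cfun_op act (a i)) y)
        \<le> norm (blinfun_apply T (blinfun_apply (cfun_op act (b i)) x)) * ?A i"
      by (rule norm_cauchy_schwarz)
    also have "\<dots> \<le> norm T * ?B i * ?A i"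
      by (intro mult_right_mono norm_blinfun) simp
    finally show "inner (blinfun_apply T (blinfun_apply (cfun_op act (b i)) x)) (blinfun_apply (cfun_op act (a i)) y)
        \<le> norm T * (\<bar>?B i\<bar> * \<bar>?A i\<bar>)"
      by (simp add: mult.assoc)
  qed
  also have "\<dots> = norm T * (\<Sum>i\<in>I. \<bar>?B i\<bar> * \<bar>?A i\<bar>)"
    by (rule sum_distrib_left[symmetric])
  also have "\<dots> \<le> norm T * (L2_set ?B I * L2_set ?A I)"
    by (intro mult_left_mono L2_set_mult_ineq) simp
  also have "\<dots> = norm T * (norm x * norm y)"
    by (simp add: L2_set_def part[OF a] part[OF b])
  finally have "norm y * norm y \<le> norm T * norm x * norm y"
    by (simp add: power2_eq_square mult.assoc)
  then have "norm y \<le> norm T * norm x"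
    using mult_right_le_imp_le[of "norm y" "norm y" "norm T * norm x"] by (cases "y = 0") auto
  then show "norm (blinfun_apply ?S x) \<le> norm T * norm x"
    unfolding y_def .
qed simp

context compact_action
begin

text \<open>
  By freeness, every point has a neighbourhood that no \<open>k \<in> D\<close> maps to a set meeting it.  Functions
  supported in finitely many such neighbourhoods are normalised so that their squares add up to one.
\<close>

lemma free_displacing_partition:
  assumes free: "free_action act" and D: "finite D" "0 \<notin> D"
  obtains I :: "'x set" and p :: "'x \<Rightarrow> 'x \<Rightarrow> real"
  where "finite I" "\<And>i. i \<in> I \<Longrightarrow> continuous_on UNIV (p i)" "\<And>y. (\<Sum>i\<in>I. (p i y)\<^sup>2) = 1"
    "\<And>i k y. i \<in> I \<Longrightarrow> k \<in> D \<Longrightarrow> p i y * p i (act k y) = 0"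
proof -
  have "\<exists>q :: 'x \<Rightarrow> real. continuous_on UNIV q \<and> q x = 1 \<and> (\<forall>k\<in>D. \<forall>y. q y * q (act k y) = 0)" for x
  proof -
    have "\<exists>V. open V \<and> x \<in> V \<and> (\<forall>y. y \<in> V \<longrightarrow> act k y \<notin> V)" if "k \<in> D" for k
    proof -
      have "k \<noteq> 0" using that D(2) by blast
      with free have "{z. act k z = z} = {}"
        by (simp add: free_action_def)
      then have "\<not> act k x = x"
        unfolding empty_Collect_eq Collect_empty_eq by (rule spec)
      then have "x \<noteq> act k x" by (rule not_sym)
      from hausdorff[OF this] obtain A B where AB: "open A" "open B" "x \<in> A" "act k x \<in> B" "A \<inter> B = {}"
        by (elim exE conjE)
      have "open (A \<inter> act k -` B)"
        using AB(1,2) continuous_act[of UNIV k] by (intro open_Int open_vimage) auto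
      with AB show ?thesis
        by (intro exI[of _ "A \<inter> act k -` B"]) auto
    qed
    then obtain V where V: "\<And>k. k \<in> D \<Longrightarrow> open (V k) \<and> x \<in> V k \<and> (\<forall>y. y \<in> V k \<longrightarrow> act k y \<notin> V k)"
      by metis
    have "open (\<Inter>k\<in>D. V k)" "x \<in> (\<Inter>k\<in>D. V k)"
      using V D(1) by auto
    then obtain q :: "'x \<Rightarrow> real" where q: "continuous_on UNIV q" "q x = 1" "\<And>y. y \<notin> (\<Inter>k\<in>D. V k) \<Longrightarrow> q y = 0"
      by (rule compact_t2_urysohn_point[OF compact_space]) blast
    have "q y * q (act k y) = 0" if "k \<in> D" for k y
      using q(3)[of y] q(3)[of "act k y"] V[OF that] that by (cases "y \<in> V k") auto
    with q(1,2) show ?thesis by blast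
  qed
  then obtain q :: "'x \<Rightarrow> 'x \<Rightarrow> real" where q: "\<And>x. continuous_on UNIV (q x)" "\<And>x. q x x = 1"
      "\<And>x k y. k \<in> D \<Longrightarrow> q x y * q x (act k y) = 0"
    by metis
  have "open {y. 0 < (q x y)\<^sup>2}" for x
    by (intro open_Collect_less continuous_intros q(1))
  moreover have "(UNIV :: 'x set) \<subseteq> (\<Union>x. {y. 0 < (q x y)\<^sup>2})"
  proof
    fix x show "x \<in> (\<Union>x. {y. 0 < (q x y)\<^sup>2})"
      using q(2)[of x] by (intro UN_I[of x]) auto
  qed
  ultimately obtain I where I: "finite I" "(UNIV :: 'x set) \<subseteq> (\<Union>x\<in>I. {y. 0 < (q x y)\<^sup>2})"
    by (rule compactE_image[OF compact_space]) blast
  define s where "s y = (\<Sum>x\<in>I. (q x y)\<^sup>2)" for y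
  have s: "0 < s y" for y
  proof -
    obtain x where "x \<in> I" "0 < (q x y)\<^sup>2" using I(2) by blast
    then show ?thesis unfolding s_def using I(1) by (intro sum_pos2[of I x]) auto
  qed
  have cs: "continuous_on UNIV s"
    unfolding s_def by (intro continuous_intros q(1))
  show thesis
  proof (rule that[of I "\<lambda>x y. q x y / sqrt (s y)"])
    show "continuous_on UNIV (\<lambda>y. q x y / sqrt (s y))" for x
      using s by (intro continuous_intros q(1) cs) (metis less_irrefl real_sqrt_eq_zero_cancel_iff)
    show "(\<Sum>x\<in>I. (q x y / sqrt (s y))\<^sup>2) = 1" for y
    proof -
      have "(\<Sum>x\<in>I. (q x y / sqrt (s y))\<^sup>2) = (\<Sum>x\<in>I. (q x y)\<^sup>2 / s y)"
        using s[of y] by (simp add: power_divide)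
      also have "\<dots> = 1"
        using s[of y] by (simp add: s_def flip: sum_divide_distrib)
      finally show ?thesis .
    qed
    show "q x y / sqrt (s y) * (q x (act k y) / sqrt (s (act k y))) = 0" if "k \<in> D" for x k y
      using q(3)[OF that, of x y] by auto
  qed (rule I(1))
qed

lemma bimodule_left:
  assumes "bimodule act M" "T \<in> M"
  shows "cfun_op act f o\<^sub>L T \<in> M"
proof -
  have "apply_bcontfun (Bcontfun (\<lambda>_ :: 'x. 1 :: complex)) = (\<lambda>_. 1)"
    by (intro apply_Bcontfun continuous_intros)
  then have "cfun_op act f o\<^sub>L T o\<^sub>L cfun_op act (Bcontfun (\<lambda>_. 1)) = cfun_op act f o\<^sub>L T"
    by (intro blinfun_eqI, simp)
      (intro arg_cong[where f = "\<lambda>z. blinfun_apply (cfun_op act f) (blinfun_apply T z)"] ell2_eqI,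
        auto simp: Rep_cfun_op)
  moreover have "cfun_op act f o\<^sub>L T o\<^sub>L cfun_op act (Bcontfun (\<lambda>_. 1)) \<in> M"
    using assms by (auto simp: bimodule_def)
  ultimately show ?thesis by simp
qed

text \<open>
  In \<open>p\<^sub>i (f u\<^sub>h) (p\<^sub>i \<circ> g)\<close> the coefficient of \<open>u\<^sub>h\<close> at \<open>y\<close> is \<open>f(y) p\<^sub>i(y) p\<^sub>i(g h\<inverse> \<cdot> y)\<close>.  If the \<open>p\<^sub>i\<close> are
  displaced by \<open>g h\<inverse>\<close>, this vanishes for \<open>h \<noteq> g\<close>, while the terms with \<open>h = g\<close> add up to \<open>f u\<^sub>g\<close>.
\<close>

lemma bimodule_contains_fourier_terms:
  assumes free: "free_action act" and M: "bimodule act M" "closed M" and T: "T \<in> M"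
  shows "monomial (fourier T g) g \<in> M"
proof -
  have TA: "T \<in> reduced_crossed_product act" and sub: "cop.subspace M"
    and sandwich: "\<And>f h. cfun_op act f o\<^sub>L T o\<^sub>L cfun_op act h \<in> M"
    using M(1) T unfolding bimodule_def by blast+
  have "\<exists>X\<in>M. dist X (monomial (fourier T g) g) < e" if e: "0 < e" for e
  proof -
    have "\<exists>R\<in>algebraic_crossed_product. dist R T < e / 2"
      using TA half_gt_zero[OF e] unfolding reduced_crossed_product_def closure_approachable by blast
    then obtain R where R: "R \<in> algebraic_crossed_product" "dist R T < e / 2" by blast
    have RA: "R \<in> reduced_crossed_product act" using R(1) algebraic_subset by blast
    obtain S where S: "finite S" "\<And>h. h \<notin> S \<Longrightarrow> fourier R h = 0" "R = (\<Sum>h\<in>S. monomial (fourier R h) h)"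
      using algebraic_fourier_sum[OF R(1)] by blast
    define D where "D = (\<lambda>h. g - h) ` (S - {g})"
    have D: "finite D" "0 \<notin> D" using S(1) by (auto simp: D_def)
    obtain I p where I: "finite (I :: 'x set)" "\<And>i. i \<in> I \<Longrightarrow> continuous_on UNIV (p i)"
        "\<And>y. (\<Sum>i\<in>I. (p i y)\<^sup>2) = (1 :: real)"
        "\<And>i k y. i \<in> I \<Longrightarrow> k \<in> D \<Longrightarrow> p i y * p i (act k y) = 0"
      using free_displacing_partition[OF free D] by blast
    \<comment> \<open>Off \<open>I\<close> the functions \<open>p i\<close> are arbitrary; setting them to zero makes all of them continuous.\<close>
    define r where "r i = (if i \<in> I then p i else (\<lambda>_. 0))" for i
    have cr: "continuous_on UNIV (r i)" for i
      by (simp add: r_def I(2))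
    define a where "a i = Bcontfun (\<lambda>y. complex_of_real (r i y))" for i
    define b where "b i = Bcontfun (\<lambda>y. complex_of_real (r i (act g y)))" for i
    have a: "apply_bcontfun (a i) y = of_real (r i y)" for i y
      unfolding a_def by (subst apply_Bcontfun) (auto intro!: continuous_intros cr)
    have b: "apply_bcontfun (b i) y = of_real (r i (act g y))" for i y
      unfolding b_def by (subst apply_Bcontfun) (auto intro!: continuous_intros continuous_on_act_compose cr)
    have r1: "(\<Sum>i\<in>I. (r i y)\<^sup>2) = 1" for y
      using I(3)[of y] by (simp add: r_def)
    define \<Phi> where "\<Phi> X = (\<Sum>i\<in>I. cfun_op act (a i) o\<^sub>L X o\<^sub>L cfun_op act (b i))" for X
    have contr: "norm (\<Phi> X) \<le> norm X" for X
      unfolding \<Phi>_def by (rule averaging_contraction[OF a r1 b r1])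
    have \<Phi>_diff: "\<Phi> X - \<Phi> Y = \<Phi> (X - Y)" for X Y
      unfolding \<Phi>_def sum_subtractf[symmetric]
      by (intro sum.cong refl linear_diff[symmetric] bounded_linear.linear bounded_linear_sandwich)
    have orth: "(\<Sum>i\<in>I. r i y * r i (act (g - h) y)) = (if h = g then 1 else 0)" if "h \<in> S" for h y
    proof (cases "h = g")
      case True
      then show ?thesis using r1[of y] by (simp add: power2_eq_square)
    next
      case False
      then have "g - h \<in> D" using that by (simp add: D_def)
      then have "(\<Sum>i\<in>I. r i y * r i (act (g - h) y)) = (\<Sum>i\<in>I. 0)"
        by (intro sum.cong refl) (simp only: r_def if_True I(4))
      then show ?thesis using False by simp
    qed
    have \<Phi>R: "\<Phi> R = monomial (fourier R g) g"
    proof (rule cop_eqI)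
      fix x and j :: "'g \<times> 'x"
      obtain t y where j: "j = (t, y)" by (cases j)
      let ?f = "\<lambda>h. apply_bcontfun (fourier R h) (act t y) * Rep_ell2 x (- h + t, y)"
      have shift: "act g (act (- h + t) y) = act (g - h) (act t y)" for h
        by (simp add: act_add diff_conv_add_uminus del: add_uminus_conv_diff)
      have "Rep_ell2 (blinfun_apply (\<Phi> R) x) j =
          (\<Sum>i\<in>I. of_real (r i (act t y)) * (\<Sum>h\<in>S. apply_bcontfun (fourier R h) (act t y) *
            (of_real (r i (act (g - h) (act t y))) * Rep_ell2 x (- h + t, y))))"
        unfolding \<Phi>_def Rep_sum_op
        by (subst (1) S(3)) (simp add: j Rep_sum_op Rep_cfun_op Rep_unitary_op a b shift)
      also have "\<dots> = (\<Sum>h\<in>S. of_real (\<Sum>i\<in>I. r i (act t y) * r i (act (g - h) (act t y))) * ?f h)"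
        unfolding sum_distrib_left of_real_sum sum_distrib_right
        by (subst sum.swap) (simp add: mult_ac)
      also have "\<dots> = (\<Sum>h\<in>S. if h = g then ?f g else 0)"
        by (intro sum.cong refl) (simp add: orth)
      also have "\<dots> = ?f g"
        using S(1,2) by simp
      finally show "Rep_ell2 (blinfun_apply (\<Phi> R) x) j = Rep_ell2 (blinfun_apply (monomial (fourier R g) g) x) j"
        unfolding j Rep_monomial .
    qed
    have "dist (\<Phi> T) (monomial (fourier T g) g) \<le> norm (\<Phi> T - \<Phi> R) + norm (monomial (fourier R g - fourier T g) g)"
      unfolding monomial_diff \<Phi>R dist_norm by norm
    also have "\<dots> \<le> norm (T - R) + norm (R - T)"
      unfolding \<Phi>_diff
      by (intro add_mono contr order_trans[OF norm_monomial_le norm_fourier_diff_le] RA TA)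
    also have "\<dots> < e"
      using R(2) by (simp add: dist_norm norm_minus_commute)
    finally have "dist (\<Phi> T) (monomial (fourier T g) g) < e" .
    moreover have "\<Phi> T \<in> M"
      unfolding \<Phi>_def by (intro cop.subspace_sum[OF sub] sandwich)
    ultimately show ?thesis by blast
  qed
  then have "monomial (fourier T g) g \<in> closure M"
    unfolding closure_approachable by blast
  with M(2) show ?thesis by simp
qed

text \<open>
  Cover the compact set \<open>L\<close> where \<open>f\<close> is not small by finitely many sets \<open>{y. E\<^sub>g(T)(y) \<noteq> 0}\<close> with
  \<open>T \<in> M\<close>.  Then \<open>h = \<Sum> \<bar>E\<^sub>g(T)\<bar>\<^sup>2\<close> is bounded below by some \<open>m > 0\<close> on \<open>L\<close>, and \<open>f h / max(h, m)\<close> agrees with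
  \<open>f\<close> on \<open>L\<close> and is close to \<open>f\<close> elsewhere.  It is a combination of the coefficients \<open>E\<^sub>g(T)\<close> with
  factors in \<open>C(X)\<close>, so its product with \<open>u\<^sub>g\<close> is in \<open>M\<close>.
\<close>

lemma bimodule_contains_supported_terms:
  assumes free: "free_action act" and M: "bimodule act M" "closed M"
    and f: "\<And>y. apply_bcontfun f y \<noteq> 0 \<Longrightarrow> \<exists>T\<in>M. coeff T g y \<noteq> 0"
  shows "monomial f g \<in> M"
proof -
  have MA: "M \<subseteq> reduced_crossed_product act" and sub: "cop.subspace M"
    using M(1) unfolding bimodule_def by blast+
  have "\<exists>X\<in>M. dist X (monomial f g) < e" if e: "0 < e" for e
  proof -
    define L where "L = {y. e / 2 \<le> cmod (apply_bcontfun f y)}"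
    have "closed L"
      unfolding L_def by (intro closed_Collect_le continuous_intros continuous_apply)
    then have L: "compact L"
      using compact_Int_closed[OF compact_space] by simp
    have open_ne: "open {y. coeff T g y \<noteq> 0}" if "T \<in> M" for T
      using continuous_coeff[of T g] MA that by (intro open_Collect_neq continuous_intros) auto
    have cover: "L \<subseteq> (\<Union>T\<in>M. {y. coeff T g y \<noteq> 0})"
    proof
      fix y assume "y \<in> L"
      then have "apply_bcontfun f y \<noteq> 0" using e by (auto simp: L_def)
      with f show "y \<in> (\<Union>T\<in>M. {y. coeff T g y \<noteq> 0})" by blast
    qed
    obtain J where J: "J \<subseteq> M" "finite J" "L \<subseteq> (\<Union>T\<in>J. {y. coeff T g y \<noteq> 0})"
      by (rule compactE_image[OF L open_ne cover]) blast
    have JA: "T \<in> reduced_crossed_product act" if "T \<in> J" for T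
      using J(1) MA that by blast
    define h where "h y = (\<Sum>T\<in>J. (cmod (coeff T g y))\<^sup>2)" for y
    have ch: "continuous_on UNIV h"
      unfolding h_def by (intro continuous_intros continuous_coeff JA)
    have h0: "0 \<le> h y" for y
      unfolding h_def by (intro sum_nonneg) simp
    have hpos: "0 < h y" if "y \<in> L" for y
    proof -
      obtain T where "T \<in> J" "coeff T g y \<noteq> 0" using J(3) \<open>y \<in> L\<close> by blast
      then show ?thesis unfolding h_def using J(2) by (intro sum_pos2[of J T]) auto
    qed
    obtain m where m: "0 < m" "\<And>y. y \<in> L \<Longrightarrow> m \<le> h y"
    proof (cases "L = {}")
      case True
      then show ?thesis using that[of 1] by simp
    next
      case False
      then obtain y where "y \<in> L" "\<forall>z\<in>L. h y \<le> h z"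
        using continuous_attains_inf[OF L False continuous_on_subset[OF ch]] by blast
      then show ?thesis using that[of "h y"] hpos by blast
    qed
    let ?d = "\<lambda>y. max (h y) m"
    have d: "0 < ?d y" for y using m(1) by simp
    define k where "k T = Bcontfun (\<lambda>y. apply_bcontfun f y * cnj (coeff T g y) / of_real (?d y))" for T
    have k: "apply_bcontfun (k T) = (\<lambda>y. apply_bcontfun f y * cnj (coeff T g y) / of_real (?d y))"
      if "T \<in> J" for T
      unfolding k_def using d
      by (intro apply_Bcontfun continuous_intros continuous_apply continuous_coeff JA that ch)
        (metis less_irrefl of_real_eq_0_iff)
    define X where "X = (\<Sum>T\<in>J. cfun_op act (k T) o\<^sub>L monomial (fourier T g) g)"
    have "X \<in> M"
      unfolding X_def using J(1)
      by (intro cop.subspace_sum[OF sub] bimodule_left[OF M(1)] bimodule_contains_fourier_terms[OF free M]) auto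
    define w where "w = Bcontfun (\<lambda>y. apply_bcontfun f y * of_real (h y / ?d y))"
    have w: "apply_bcontfun w = (\<lambda>y. apply_bcontfun f y * of_real (h y / ?d y))"
      unfolding w_def using d
      by (intro apply_Bcontfun continuous_intros continuous_apply ch) (metis less_irrefl)
    have X: "X = monomial w g"
    proof (rule cop_eqI)
      fix x and j :: "'g \<times> 'x"
      obtain t y where j: "j = (t, y)" by (cases j)
      let ?y = "act t y"
      have "Rep_ell2 (blinfun_apply X x) j =
          (\<Sum>T\<in>J. apply_bcontfun f ?y * cnj (coeff T g ?y) / of_real (?d ?y) *
            (coeff T g ?y * Rep_ell2 x (- g + t, y)))"
        unfolding X_def j Rep_sum_op
        by (intro sum.cong refl) (simp add: Rep_cfun_op Rep_unitary_op k apply_fourier JA)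
      also have "\<dots> = (\<Sum>T\<in>J. of_real ((cmod (coeff T g ?y))\<^sup>2) *
            (apply_bcontfun f ?y / of_real (?d ?y) * Rep_ell2 x (- g + t, y)))"
        by (intro sum.cong refl) (simp add: complex_norm_square mult_ac del: of_real_power)
      also have "\<dots> = of_real (h ?y) * (apply_bcontfun f ?y / of_real (?d ?y) * Rep_ell2 x (- g + t, y))"
        unfolding h_def of_real_sum sum_distrib_right ..
      finally show "Rep_ell2 (blinfun_apply X x) j = Rep_ell2 (blinfun_apply (monomial w g) x) j"
        unfolding j Rep_monomial w by simp
    qed
    have "norm (w - f) \<le> e / 2"
    proof (rule norm_bound)
      fix y
      have "apply_bcontfun (w - f) y = apply_bcontfun f y * of_real (h y / ?d y - 1)"
        by (simp add: w algebra_simps)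
      then have eq: "norm (apply_bcontfun (w - f) y) = cmod (apply_bcontfun f y) * \<bar>h y / ?d y - 1\<bar>"
        by (simp only: norm_mult norm_of_real)
      show "norm (apply_bcontfun (w - f) y) \<le> e / 2"
      proof (cases "y \<in> L")
        case True
        then have "?d y = h y" "h y \<noteq> 0" using m(2)[of y] hpos[of y] by auto
        then show ?thesis unfolding eq using e by simp
      next
        case False
        have "0 \<le> h y / ?d y" "h y / ?d y \<le> 1" using d[of y] h0[of y] by auto
        then have "\<bar>h y / ?d y - 1\<bar> \<le> 1" by linarith
        then have "cmod (apply_bcontfun f y) * \<bar>h y / ?d y - 1\<bar> \<le> cmod (apply_bcontfun f y) * 1"
          by (intro mult_left_mono) auto
        also have "\<dots> \<le> e / 2" using False by (simp add: L_def)
        finally show ?thesis unfolding eq .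
      qed
    qed
    then have "dist X (monomial f g) \<le> e / 2"
      unfolding X dist_norm monomial_diff[symmetric] using norm_monomial_le order_trans by blast
    then show ?thesis using e \<open>X \<in> M\<close> by (intro bexI[of _ X]) auto
  qed
  then have "monomial f g \<in> closure M"
    unfolding closure_approachable by blast
  with M(2) show ?thesis by simp
qed

end

section \<open>The correspondence\<close>

lemma openin_discrete_prod_iff:
  "openin (prod_topology (discrete_topology UNIV) euclidean) U \<longleftrightarrow> (\<forall>g. open (slice g U))"
proof
  assume U: "openin (prod_topology (discrete_topology UNIV) euclidean) U"
  show "\<forall>g. open (slice g U)"
  proof
    fix g
    have "\<exists>V. open V \<and> x \<in> V \<and> V \<subseteq> slice g U" if x: "x \<in> slice g U" for x
    proof -
      have "\<exists>A V. open V \<and> g \<in> A \<and> x \<in> V \<and> A \<times> V \<subseteq> U"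
        using U x by (simp add: openin_prod_topology_alt slice_def)
      then obtain A V where "open V" "g \<in> A" "x \<in> V" "A \<times> V \<subseteq> U"
        by (elim exE conjE)
      then show ?thesis by (intro exI[of _ V]) (auto simp: slice_def)
    qed
    then show "open (slice g U)" by (subst open_subopen) blast
  qed
next
  assume U: "\<forall>g. open (slice g U)"
  show "openin (prod_topology (discrete_topology UNIV) euclidean) U"
    unfolding openin_prod_topology_alt
  proof (intro allI impI)
    fix g x assume "(g, x) \<in> U"
    with U show "\<exists>A V. openin (discrete_topology UNIV) A \<and> openin euclidean V \<and> g \<in> A \<and> x \<in> V \<and> A \<times> V \<subseteq> U"
      by (intro exI[of _ "{g}"] exI[of _ "slice g U"]) (auto simp: slice_def)
  qed
qed

context compact_action
begin

definition bimodule_support :: "(('g \<times> 'x) ell2 \<Rightarrow>\<^sub>L ('g \<times> 'x) ell2) set \<Rightarrow> ('g \<times> 'x) set" where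
  "bimodule_support M = {(g, y). \<exists>T\<in>M. coeff T g y \<noteq> 0}"

lemma open_slice_bimodule_support:
  assumes "bimodule act M"
  shows "open (slice g (bimodule_support M))"
proof -
  have "slice g (bimodule_support M) = (\<Union>T\<in>M. {y. coeff T g y \<noteq> 0})"
    by (auto simp: slice_def bimodule_support_def)
  moreover have "open {y. coeff T g y \<noteq> 0}" if "T \<in> M" for T
    using assms that by (intro open_Collect_neq continuous_coeff continuous_on_const)
      (auto simp: bimodule_def)
  ultimately show ?thesis by auto
qed

lemma generator_in_bimodule_of:
  assumes "supp f \<subseteq> slice g U"
  shows "monomial f g \<in> bimodule_of act U"
  unfolding bimodule_of_def using assms
  by (intro subsetD[OF closure_subset] cop.span_base) blast

lemma bimodule_bimodule_of: "bimodule act (bimodule_of act U)"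
proof -
  let ?G = "{monomial f g | f g. supp f \<subseteq> slice g U}"
  have "bimodule_of act U \<subseteq> reduced_crossed_product act"
    unfolding bimodule_of_def reduced_crossed_product_def
    by (intro closure_mono cop.span_mono) blast
  moreover have "cop.subspace (bimodule_of act U)"
    unfolding bimodule_of_def by (intro cop_subspace_closure cop.subspace_span)
  moreover have "cfun_op act a o\<^sub>L T o\<^sub>L cfun_op act b \<in> bimodule_of act U"
    if "T \<in> bimodule_of act U" for T a b
  proof -
    have span: "cfun_op act a o\<^sub>L X o\<^sub>L cfun_op act b \<in> cop.span ?G" if "X \<in> cop.span ?G" for X
      using that
    proof (induction rule: cop.span_induct_alt)
      case base
      have "cfun_op act a o\<^sub>L 0 o\<^sub>L cfun_op act b = 0"
        by (rule linear_0[OF bounded_linear.linear[OF bounded_linear_sandwich]])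
      then show ?case by (simp only: cop.span_zero)
    next
      case (step c X Y)
      from step(1) obtain f g where X: "X = monomial f g" "supp f \<subseteq> slice g U" by blast
      let ?p = "\<lambda>y. apply_bcontfun a y * apply_bcontfun f y * apply_bcontfun b (act (- g) y)"
      have "apply_bcontfun (Bcontfun ?p) = ?p"
        by (intro apply_Bcontfun continuous_intros continuous_apply continuous_on_act_compose)
      then have "supp (Bcontfun ?p) \<subseteq> slice g U"
        using X(2) unfolding supp_def by auto
      then have "cfun_op act a o\<^sub>L X o\<^sub>L cfun_op act b \<in> cop.span ?G"
        unfolding X(1) sandwich_monomial by (intro cop.span_base) blast
      moreover have "cfun_op act a o\<^sub>L (cop_scale c X + Y) o\<^sub>L cfun_op act b =
          cop_scale c (cfun_op act a o\<^sub>L X o\<^sub>L cfun_op act b) + (cfun_op act a o\<^sub>L Y o\<^sub>L cfun_op act b)"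
        by (rule cop_eqI)
          (auto simp: blinfun.add_left blinfun.add_right plus_ell2.rep_eq Rep_cfun_op Rep_cop_scale algebra_simps)
      ultimately show ?case
        using step(2) by (simp only: cop.span_add cop.span_scale)
    qed
    have "cfun_op act a o\<^sub>L X o\<^sub>L cfun_op act b \<in> closure (cop.span ?G)" if "X \<in> cop.span ?G" for X
      by (rule subsetD[OF closure_subset span[OF that]])
    with bounded_linear_sandwich show ?thesis
      using that unfolding bimodule_of_def by (rule closure_mapped_into)
  qed
  ultimately show ?thesis unfolding bimodule_def by blast
qed

lemma coeff_bimodule_of_eq_0:
  assumes T: "T \<in> bimodule_of act U" and y: "(g, y) \<notin> U"
  shows "coeff T g y = 0"
proof (rule ccontr)
  assume "coeff T g y \<noteq> 0"
  then have "0 < cmod (coeff T g y)" by simp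
  with T obtain R where R: "R \<in> cop.span {monomial f h | f h. supp f \<subseteq> slice h U}"
      "dist R T < cmod (coeff T g y)"
    unfolding bimodule_of_def closure_approachable by blast
  from R(1) have "coeff R g y = 0"
  proof (induction rule: cop.span_induct_alt)
    case (step c X Y)
    then obtain f h where X: "X = monomial f h" "supp f \<subseteq> slice h U" by blast
    have "coeff X g y = 0"
      using X(2) y by (auto simp: X(1) coeff_monomial supp_def slice_def)
    with step(2) show ?case by (simp add: coeff_add coeff_scale)
  qed (simp add: coeff_zero)
  then show False
    using norm_coeff_le[of "R - T" g y] R(2) by (simp add: coeff_diff dist_norm)
qed

lemma bimodule_support_bimodule_of:
  assumes U: "\<And>g. open (slice g U)"
  shows "bimodule_support (bimodule_of act U) = U"
proof -
  have "\<exists>T\<in>bimodule_of act U. coeff T g y \<noteq> 0" if "(g, y) \<in> U" for g y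
  proof -
    have "y \<in> slice g U" using that by (simp add: slice_def)
    then obtain q :: "'x \<Rightarrow> real" where q: "continuous_on UNIV q" "q y = 1" "\<And>z. z \<notin> slice g U \<Longrightarrow> q z = 0"
      by (rule compact_t2_urysohn_point[OF compact_space U]) blast
    define f where "f = Bcontfun (\<lambda>z. complex_of_real (q z))"
    have f: "apply_bcontfun f = (\<lambda>z. of_real (q z))"
      unfolding f_def by (intro apply_Bcontfun continuous_intros q(1))
    have "supp f \<subseteq> slice g U" using q(3) by (auto simp: supp_def f)
    moreover have "coeff (monomial f g) g y = 1" by (simp only: coeff_monomial f q(2)) simp
    ultimately show ?thesis using generator_in_bimodule_of by (metis zero_neq_one)
  qed
  moreover have "(g, y) \<in> U" if "T \<in> bimodule_of act U" "coeff T g y \<noteq> 0" for T g y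
    using coeff_bimodule_of_eq_0[OF that(1)] that(2) by blast
  ultimately show ?thesis
    by (auto simp: bimodule_support_def)
qed

lemma bimodule_of_bimodule_support:
  assumes AP: "approximation_property TYPE('g)" and free: "free_action act"
    and M: "bimodule act M" "closed M"
  shows "bimodule_of act (bimodule_support M) = M"
proof
  have MA: "M \<subseteq> reduced_crossed_product act" and sub: "cop.subspace M"
    using M(1) unfolding bimodule_def by blast+
  have "{monomial f g | f g. supp f \<subseteq> slice g (bimodule_support M)} \<subseteq> M"
  proof clarify
    fix f g assume "supp f \<subseteq> slice g (bimodule_support M)"
    then show "monomial f g \<in> M"
      by (intro bimodule_contains_supported_terms[OF free M])
        (auto simp: supp_def slice_def bimodule_support_def)
  qed
  then show "bimodule_of act (bimodule_support M) \<subseteq> M"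
    unfolding bimodule_of_def by (intro closure_minimal cop.span_minimal sub M(2))
  show "M \<subseteq> bimodule_of act (bimodule_support M)"
  proof
    fix T assume T: "T \<in> M"
    with MA have TA: "T \<in> reduced_crossed_product act" by blast
    show "T \<in> bimodule_of act (bimodule_support M)"
    proof (rule fourier_synthesis[OF AP TA])
      show "cop.subspace (bimodule_of act (bimodule_support M))"
        using bimodule_bimodule_of by (simp add: bimodule_def)
      show "closed (bimodule_of act (bimodule_support M))"
        by (simp add: bimodule_of_def)
      show "monomial (fourier T g) g \<in> bimodule_of act (bimodule_support M)" for g
        using T by (intro generator_in_bimodule_of)
          (auto simp: supp_def slice_def bimodule_support_def apply_fourier[OF TA])
    qed
  qed
qed

end

theorem theorem5p7:
  fixes act :: "'g::group_add \<Rightarrow> 'x::t2_space \<Rightarrow> 'x"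
  assumes "approximation_property TYPE('g)"
    and "compact (UNIV :: 'x set)"
    and "action_by_homeos act"
    and "free_action act"
  shows "bij_betw (bimodule_of act)
     {U. openin (prod_topology (discrete_topology UNIV) euclidean) U}
     {M. bimodule act M \<and> closed M}"
proof -
  interpret compact_action act
    using assms(2,3) by (rule compact_action.intro)
  show ?thesis
  proof (rule bij_betw_byWitness[where f' = bimodule_support])
    show "\<forall>U\<in>{U. openin (prod_topology (discrete_topology UNIV) euclidean) U}.
        bimodule_support (bimodule_of act U) = U"
      by (simp add: openin_discrete_prod_iff bimodule_support_bimodule_of)
    show "\<forall>M\<in>{M. bimodule act M \<and> closed M}. bimodule_of act (bimodule_support M) = M"
      using bimodule_of_bimodule_support[OF assms(1,4)] by blast
    show "bimodule_of act ` {U. openin (prod_topology (discrete_topology UNIV) euclidean) U}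
        \<subseteq> {M. bimodule act M \<and> closed M}"
      using bimodule_bimodule_of by (auto simp: bimodule_of_def)
    show "bimodule_support ` {M. bimodule act M \<and> closed M}
        \<subseteq> {U. openin (prod_topology (discrete_topology UNIV) euclidean) U}"
      by (auto simp: openin_discrete_prod_iff open_slice_bimodule_support)
  qed
qed

end
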